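(* Let $H$ be a real Hilbert space and let $A$ be a (possibly multivalued) maximal monotone operator in $H$ with $D(A)=H$. Let $\{x_n\}_{n\ge 0}\subset H$ be any sequence generated by the iteration scheme described in the context (for any admissible choice of $\{\theta_\mu\}$, $x_0$, $y_0$, $r_0$, $z\in A0$ and $y_n\in Ax_n$), and let $v_n=\theta_{\mu(n)}x_n$, where $\mu(n)$ is the value of the index $\mu$ with which the update $x_n\mapsto x_{n+1}$ in Step 2 is performed. (i) If $A^{-1}0\neq\emptyset$, then $x_n$ converges strongly to $p$, where $p$ is the element of $A^{-1}0$ with minimum norm. (ii) If $A^{-1}0=\emptyset$, then $|x_n|\to\infty$ in such a way that $v_n$ converges (strongly) to $-a^0$, where $a^0$ is the element of $\overline{R(A)}$ with minimum norm.
   Context: Notation. $H$ is a real Hilbert space with inner product $(\cdot,\cdot)$ and norm $|\cdot|$. A possibly multivalued operator $A$ in $H$ assigns to each $x\in H$ a subset $Ax\subset H$; $D(A)=\{x: Ax\ne\emptyset\}$, $R(A)=\bigcup_{x}Ax$, and $A^{-1}0=\{x\in H: 0\in Ax\}$. $A$ is monotone if $(y_1-y_2,x_1-x_2)\ge 0$ for all $x_i\in D(A)$ and $y_i\in Ax_i$, $i=1,2$; it is maximal monotone if its graph is not properly contained in the graph of another monotone operator. $\overline{R(A)}$ is the norm closure of $R(A)$. Iteration scheme. Choose any decreasing positive sequence $\{\theta_\mu\}_{\mu\ge 0}$ such that the sequence $\{\rho_\mu\}_{\mu\ge0}$, where $\rho_\mu=\frac{1}{\theta_{\mu+1}}-\frac{1}{\theta_\mu}$,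 is also positive and decreasing, and $\lim_{\mu\to\infty}\theta_\mu=\lim_{\mu\to\infty}\rho_\mu=0$. Fix $z\in A0$. Step 1. Choose $x_0\in H$ and set $\mu=0$ (and $n=0$). Choose $r_0$ such that for some $y_0\in Ax_0$ one has $|x_0+\frac{1}{\theta_0}y_0|\le r_0$. Step 2. If $r_n\le\rho_\mu$, go to Step 3. Otherwise take $y_n\in Ax_n$, set $$\lambda_n=\min\Big\{\frac{1}{2\theta_\mu},\ \frac{\theta_\mu r_n^2}{|y_n+\theta_\mu x_n|^2}\Big\}$$ (the second quantity being read as $+\infty$ when $y_n+\theta_\mu x_n=0$), and compute $$x_{n+1}=x_n-\lambda_n(y_n+\theta_\mu x_n)$$ and $r_{n+1}\ge 0$ from $$r_{n+1}^2=(1-2\theta_\mu\lambda_n)\,r_n^2+\lambda_n^2\,|y_n+\theta_\mu x_n|^2.$$ Repeat Step 2 (with $n$ replaced by $n+1$ and the same $\mu$). Step 3. Redefine $r_n=(1+|z|)\rho_\mu$. Then increase $\mu$ by $1$ (leaving $n$ and $x_n$ unchanged) and go back to Step 2. *)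

theory Defs
  imports "HOL-Analysis.Analysis"
begin

section \<open>Multivalued operators\<close>

type_synonym 'a operator = "'a \<Rightarrow> 'a set"

definition op_graph :: "'a operator \<Rightarrow> ('a \<times> 'a) set" where
  "op_graph A = {(x, y). y \<in> A x}"

definition op_domain :: "'a operator \<Rightarrow> 'a set" where
  "op_domain A = {x. A x \<noteq> {}}"

definition op_range :: "'a operator \<Rightarrow> 'a set" where
  "op_range A = (\<Union>x. A x)"

definition op_zeros :: "'a::zero operator \<Rightarrow> 'a set" where
  "op_zeros A = {x. 0 \<in> A x}"

definition monotone_op :: "'a::real_inner operator \<Rightarrow> bool" where
  "monotone_op A \<longleftrightarrow>
     (\<forall>x1 x2. \<forall>y1\<in>A x1. \<forall>y2\<in>A x2. (y1 - y2) \<bullet> (x1 - x2) \<ge> 0)"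

definition maximal_monotone :: "'a::real_inner operator \<Rightarrow> bool" where
  "maximal_monotone A \<longleftrightarrow>
     monotone_op A \<and> \<not> (\<exists>B. monotone_op B \<and> op_graph A \<subset> op_graph B)"

abbreviation min_norm_in :: "'a::real_normed_vector set \<Rightarrow> 'a \<Rightarrow> bool" where
  "min_norm_in S \<equiv> is_arg_min norm (\<lambda>q. q \<in> S)"


section \<open>The iteration scheme\<close>

definition rho :: "(nat \<Rightarrow> real) \<Rightarrow> nat \<Rightarrow> real" where
  "rho \<theta> \<mu> = 1 / \<theta> (Suc \<mu>) - 1 / \<theta> \<mu>"

text \<open>``Decreasing'' is read as ``non-increasing'', so strictly decreasing sequences are covered.
  For \<open>\<theta>\<close> the two readings agree, by positivity of \<open>rho \<theta>\<close>.\<close>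

definition admissible :: "(nat \<Rightarrow> real) \<Rightarrow> bool" where
  "admissible \<theta> \<longleftrightarrow>
     (\<forall>\<mu>. \<theta> \<mu> > 0) \<and> decseq \<theta> \<and>
     (\<forall>\<mu>. rho \<theta> \<mu> > 0) \<and> decseq (rho \<theta>) \<and>
     \<theta> \<longlonglongrightarrow> 0 \<and> rho \<theta> \<longlonglongrightarrow> 0"

text \<open>Step size for the current value \<open>t\<close> of \<open>\<theta>\<close>, the current radius \<open>r\<close> and \<open>w = y + t x\<close>.
  For \<open>w = 0\<close> the second quantity in the minimum is \<open>+\<infinity>\<close>, whereas \<open>c / 0 = 0\<close> in HOL.\<close>

definition step_size :: "real \<Rightarrow> real \<Rightarrow> 'a::real_normed_vector \<Rightarrow> real" where
  "step_size t r w =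
     (if w = 0 then 1 / (2 * t) else min (1 / (2 * t)) (t * r\<^sup>2 / (norm w)\<^sup>2))"

text \<open>A state \<open>(n, \<mu>, x, r)\<close> holds the current values of \<open>n\<close>, \<open>\<mu>\<close>, \<open>x\<^sub>n\<close> and \<open>r\<^sub>n\<close>
  whenever the test \<open>r\<^sub>n \<le> \<rho>\<^sub>\<mu>\<close> at the beginning of Step 2 is evaluated.\<close>

type_synonym 'a state = "nat \<times> nat \<times> 'a \<times> real"

inductive transition ::
    "'a::real_inner operator \<Rightarrow> (nat \<Rightarrow> real) \<Rightarrow> 'a \<Rightarrow> 'a state \<Rightarrow> 'a state \<Rightarrow> bool"
  for A :: "'a::real_inner operator" and \<theta> :: "nat \<Rightarrow> real" and z :: 'a where
  step2: "transition A \<theta> z (n, \<mu>, x, r) (Suc n, \<mu>, x - l *\<^sub>R w, r')"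
    if "\<not> r \<le> rho \<theta> \<mu>" "y \<in> A x" "w = y + \<theta> \<mu> *\<^sub>R x" "l = step_size (\<theta> \<mu>) r w"
       "r' \<ge> 0" "r'\<^sup>2 = (1 - 2 * \<theta> \<mu> * l) * r\<^sup>2 + l\<^sup>2 * (norm w)\<^sup>2"
| step3: "transition A \<theta> z (n, \<mu>, x, r) (n, Suc \<mu>, x, (1 + norm z) * rho \<theta> \<mu>)"
    if "r \<le> rho \<theta> \<mu>"

definition initial_state :: "'a::real_inner operator \<Rightarrow> (nat \<Rightarrow> real) \<Rightarrow> 'a state \<Rightarrow> bool" where
  "initial_state A \<theta> s \<longleftrightarrow>
     (\<exists>x0 r0. s = (0, 0, x0, r0) \<and> (\<exists>y0\<in>A x0. norm (x0 + (1 / \<theta> 0) *\<^sub>R y0) \<le> r0))"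

definition execution ::
    "'a::real_inner operator \<Rightarrow> (nat \<Rightarrow> real) \<Rightarrow> 'a \<Rightarrow> (nat \<Rightarrow> 'a state) \<Rightarrow> bool" where
  "execution A \<theta> z \<sigma> \<longleftrightarrow>
     initial_state A \<theta> (\<sigma> 0) \<and> (\<forall>k. transition A \<theta> z (\<sigma> k) (\<sigma> (Suc k)))"

text \<open>\<open>x n\<close> is the \<open>n\<close>-th iterate of some execution, and \<open>m n\<close> is the value of the index \<open>\<mu>\<close>
  with which the update from \<open>x n\<close> to \<open>x (Suc n)\<close> is performed. That update takes place in
  the state with first component \<open>n\<close> in which the test \<open>r\<^sub>n \<le> \<rho>\<^sub>\<mu>\<close> fails; there is
  at most one such state, as the update increments \<open>n\<close>.\<close>

definition generated ::
    "'a::real_inner operator \<Rightarrow> (nat \<Rightarrow> real) \<Rightarrow> 'a \<Rightarrow> (nat \<Rightarrow> 'a) \<Rightarrow> (nat \<Rightarrow> nat) \<Rightarrow> bool" where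
  "generated A \<theta> z x m \<longleftrightarrow>
     (\<exists>\<sigma>. execution A \<theta> z \<sigma> \<and>
        (\<forall>n. \<exists>k r. \<sigma> k = (n, m n, x n, r) \<and> \<not> r \<le> rho \<theta> (m n)))"

end

theory Submission
  imports Defs
begin

text \<open>Let \<open>u\<^sub>\<mu>\<close> be the solution of \<open>0 \<in> A u + \<theta>\<^sub>\<mu> u\<close>. The radius \<open>r\<^sub>n\<close> always bounds
  \<open>|x\<^sub>n - u\<^sub>\<mu>|\<close>: Step 2 preserves this by strong monotonicity of \<open>A + \<theta>\<^sub>\<mu> I\<close>, and Step 3 because
  \<open>|u\<^sub>\<mu> - u\<^sub>\<mu>\<^sub>+\<^sub>1| \<le> |z| \<rho>\<^sub>\<mu>\<close>. As \<open>\<rho>\<^sub>\<mu>\<close> tends to 0, the iterates inherit the asymptotics of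
  \<open>u\<^sub>\<mu>\<close>: with monotone norms, \<open>u\<^sub>\<mu>\<close> (if bounded) and \<open>\<theta>\<^sub>\<mu> u\<^sub>\<mu>\<close> are Cauchy, and their limits
  are the minimum norm elements up to sign.

  That Step 3 is reached again and again, and that \<open>u\<^sub>\<mu>\<close> exists at all, both rest on one fact:
  a trajectory \<open>x\<^sub>n\<^sub>+\<^sub>1 = x\<^sub>n - l\<^sub>n w\<^sub>n\<close> with \<open>w\<^sub>n \<in> B x\<^sub>n\<close>, \<open>\<Sum> l\<^sub>n < \<infinity>\<close> and
  \<open>\<Sum> l\<^sub>n\<^sup>2 |w\<^sub>n|\<^sup>2 < \<infinity>\<close> is almost Fejer monotone with respect to a ball on which \<open>B\<close> is bounded,
  so it converges strongly and \<open>w\<^sub>n\<close> stays bounded.\<close>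

section \<open>Everywhere defined monotone operators\<close>

text \<open>Used with \<open>p = 1\<close> to compare a trajectory with its partial lengths, and
  with \<open>p = 2\<close> to compare vectors with their squared norms.\<close>

lemma Cauchy_if_dist_power_le:
  fixes x :: "nat \<Rightarrow> 'a::metric_space" and a :: "nat \<Rightarrow> 'b::metric_space"
  assumes "Cauchy a" and le: "\<And>m n. m \<le> n \<Longrightarrow> dist (x m) (x n) ^ p \<le> dist (a m) (a n)"
  shows "Cauchy x"
proof (rule metric_CauchyI)
  fix e :: real
  assume "0 < e"
  then obtain N where N: "\<And>m n. m \<ge> N \<Longrightarrow> n \<ge> N \<Longrightarrow> dist (a m) (a n) < e ^ p"
    using metric_CauchyD[OF \<open>Cauchy a\<close>, of "e ^ p"] by auto
  have "dist (x m) (x n) < e" if "N \<le> m" "N \<le> n" "m \<le> n" for m n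
    using le[of m n] N[of m n] that \<open>0 < e\<close>
    by (intro power_less_imp_less_base[of _ p e]) auto
  then show "\<exists>M. \<forall>m\<ge>M. \<forall>n\<ge>M. dist (x m) (x n) < e"
    by (metis dist_commute nat_le_linear)
qed

text \<open>Baire category: the closed sets \<open>C k\<close> cover the space, so one of them
  contains a ball. One-sided bounds suffice because \<open>h\<close> ranges over all
  directions.\<close>

lemma uniform_boundedness_inner:
  fixes S :: "'a::{real_inner, complete_space} set"
  assumes "\<And>h. \<exists>C. \<forall>f\<in>S. f \<bullet> h \<le> C"
  shows "\<exists>K. \<forall>f\<in>S. norm f \<le> K"
proof -
  define C where "C k = {h. \<forall>f\<in>S. f \<bullet> h \<le> real k}" for k
  have cover: "\<exists>k. h \<in> C k" for h
  proof -
    obtain c where "\<forall>f\<in>S. f \<bullet> h \<le> c" using assms by blast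
    moreover obtain k where "c \<le> real k" using real_arch_simple by blast
    ultimately show ?thesis unfolding C_def by (force intro: order_trans)
  qed
  have closed: "closed (C k)" for k
  proof -
    have "C k = (\<Inter>f\<in>S. {h. f \<bullet> h \<le> real k})" by (auto simp: C_def)
    then show ?thesis by (simp only:) (intro closed_INT ballI closed_Collect_le continuous_intros)
  qed
  have "\<exists>k. interior (C k) \<noteq> {}"
  proof (rule ccontr)
    assume "\<not> ?thesis"
    then have "Met_TC.mtopology interior_of \<Union>(range C) = ({} :: 'a set)"
      using closed complete_UNIV
      by (intro Met_TC.metric_Baire_category_alt)
         (auto simp: mcomplete_iff_complete)
    moreover have "\<Union>(range C) = UNIV" using cover by auto
    ultimately show False by simp
  qed
  then obtain k c e where e: "e > 0" "cball c e \<subseteq> C k"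
    by (metis ex_in_conv mem_interior_cball)
  \<comment> \<open>The ball is centred at \<open>c\<close> instead of 0; a bound at
    \<open>- c\<close> removes the contribution of the centre.\<close>
  obtain j where j: "- c \<in> C j" using cover by blast
  have "norm f \<le> (real k + real j) / e" if "f \<in> S" for f
  proof -
    have "c + e *\<^sub>R sgn f \<in> C k"
      using e by (intro subsetD[OF e(2)]) (auto simp: dist_norm norm_sgn)
    then have "f \<bullet> c + e * (f \<bullet> sgn f) \<le> real k"
      using that by (auto simp: C_def inner_add_right)
    moreover have "f \<bullet> sgn f = norm f"
      by (cases "f = 0") (auto simp: sgn_div_norm dot_square_norm power2_eq_square)
    moreover have "- (f \<bullet> c) \<le> real j" using j that by (auto simp: C_def)
    ultimately show ?thesis using e(1) by (simp add: pos_le_divide_eq mult.commute)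
  qed
  then show ?thesis by blast
qed


section \<open>Local boundedness and trajectories with summable steps\<close>

text \<open>Divided by \<open>1 + norm \<eta> * norm (v - c)\<close>, the values
  \<open>\<eta>\<close> form a pointwise bounded family. Uniform boundedness then gives
  \<open>norm \<eta> \<le> L * (1 + norm \<eta> * norm (v - c))\<close>, and on a small ball the
  left side absorbs the second term on the right.\<close>

lemma monotone_op_locally_bounded:
  fixes B :: "'a::{real_inner, complete_space} operator"
  assumes mono: "monotone_op B" and dom: "op_domain B = UNIV"
  shows "\<exists>\<delta>>0. \<exists>M. \<forall>v. \<forall>\<eta>\<in>B v. norm (v - c) \<le> \<delta> \<longrightarrow> norm \<eta> \<le> M"
proof -
  define g where "g v \<eta> = (1 / (1 + norm \<eta> * norm (v - c))) *\<^sub>R \<eta>" for v \<eta> :: 'a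
  define S where "S = {g v \<eta> | v \<eta>. \<eta> \<in> B v \<and> norm (v - c) \<le> 1}"
  have "\<exists>C. \<forall>f\<in>S. f \<bullet> h \<le> C" for h
  proof -
    \<comment> \<open>Monotonicity is tested against a value at the shifted point
      \<open>c + h\<close>; this is what isolates \<open>\<eta> \<bullet> h\<close>.\<close>
    obtain \<zeta> where \<zeta>: "\<zeta> \<in> B (c + h)" using dom by (auto simp: op_domain_def)
    have "g v \<eta> \<bullet> h \<le> 1 + norm \<zeta> * (1 + norm h)" if "\<eta> \<in> B v" "norm (v - c) \<le> 1" for v \<eta>
    proof -
      define a where "a = norm \<eta> * norm (v - c)"
      have a: "a \<ge> 0" by (simp add: a_def)
      have "(\<eta> - \<zeta>) \<bullet> (v - (c + h)) \<ge> 0"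
        using mono \<zeta> that(1) by (auto simp: monotone_op_def)
      then have "\<eta> \<bullet> h \<le> \<eta> \<bullet> (v - c) + (- \<zeta>) \<bullet> (v - c - h)"
        by (simp add: inner_diff_left inner_diff_right inner_add_right)
      also have "\<dots> \<le> a + norm \<zeta> * norm (v - c - h)"
        using norm_cauchy_schwarz[of "- \<zeta>" "v - c - h"]
        by (intro add_mono) (simp_all add: a_def norm_cauchy_schwarz)
      also have "\<dots> \<le> a + norm \<zeta> * (1 + norm h)"
        using that(2) norm_triangle_ineq4[of "v - c" h] by (intro add_left_mono mult_left_mono) auto
      also have "\<dots> \<le> (1 + norm \<zeta> * (1 + norm h)) * (1 + a)"
        using a by (simp add: algebra_simps add_nonneg_nonneg)
      finally show ?thesis using a by (simp add: g_def a_def[symmetric] pos_divide_le_eq)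
    qed
    then show ?thesis unfolding S_def by blast
  qed
  then obtain K where K: "\<And>f. f \<in> S \<Longrightarrow> norm f \<le> K"
    using uniform_boundedness_inner by metis
  \<comment> \<open>\<open>L \<ge> 1\<close> keeps the final radius \<open>1 / (2 * L)\<close>
    within the unit ball on which \<open>S\<close> is defined.\<close>
  define L where "L = \<bar>K\<bar> + 1"
  have L: "L \<ge> 1" by (simp add: L_def)
  have "norm \<eta> \<le> 2 * L" if "\<eta> \<in> B v" "norm (v - c) \<le> 1 / (2 * L)" for v \<eta>
  proof -
    have "1 / (2 * L) \<le> 1" using L by simp
    then have "norm (v - c) \<le> 1" using that(2) by linarith
    then have "g v \<eta> \<in> S" using that(1) unfolding S_def by blast
    then have "norm (g v \<eta>) \<le> L" using K[of "g v \<eta>"] by (simp add: L_def)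
    moreover have "1 + norm \<eta> * norm (v - c) > 0" by (simp add: add_pos_nonneg)
    ultimately have "norm \<eta> \<le> L * (1 + norm \<eta> * norm (v - c))"
      by (simp add: g_def pos_divide_le_eq)
    also have "\<dots> \<le> L * (1 + norm \<eta> * (1 / (2 * L)))"
      using that(2) L by (intro mult_left_mono add_left_mono) auto
    also have "\<dots> = L + norm \<eta> / 2" using L by (simp add: field_simps)
    finally show ?thesis by simp
  qed
  then show ?thesis using L by (intro exI[of _ "1 / (2 * L)"] conjI exI[of _ "2 * L"]) auto
qed

text \<open>Local boundedness enters twice: near 0, where it gives a whole ball of admissible
  centres with one constant \<open>M\<close>, and at the strong limit of the trajectory, where it
  bounds the directions.\<close>

lemma summable_steps_imp_bounded:
  fixes B :: "'a::{real_inner, complete_space} operator"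
    and x w :: "nat \<Rightarrow> 'a" and l :: "nat \<Rightarrow> real"
  assumes mono: "monotone_op B" and dom: "op_domain B = UNIV"
    and w: "\<And>n. w n \<in> B (x n)" and x: "\<And>n. x (Suc n) = x n - l n *\<^sub>R w n"
    and l: "\<And>n. 0 \<le> l n" "summable l" and e: "summable (\<lambda>n. (l n)\<^sup>2 * (norm (w n))\<^sup>2)"
  shows "\<exists>K. \<forall>n. norm (w n) \<le> K"
proof -
  define e where "e n = (l n)\<^sup>2 * (norm (w n))\<^sup>2" for n
  have e0: "e n \<ge> 0" for n by (simp add: e_def)
  have se: "summable e" using e by (simp add: e_def[abs_def])
  have step: "(norm (x (Suc n) - v))\<^sup>2 \<le> (norm (x n - v))\<^sup>2 - 2 * l n * (\<eta> \<bullet> (x n - v)) + e n"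
    if "\<eta> \<in> B v" for n v \<eta>
  proof -
    have "(norm (x (Suc n) - v))\<^sup>2 = (norm (x n - v))\<^sup>2 - 2 * l n * (w n \<bullet> (x n - v)) + e n"
      unfolding x e_def power2_norm_eq_inner
      by (simp add: inner_diff_left inner_diff_right inner_commute power2_eq_square algebra_simps)
    moreover have "(w n - \<eta>) \<bullet> (x n - v) \<ge> 0"
      using mono w that by (auto simp: monotone_op_def)
    then have "2 * l n * (\<eta> \<bullet> (x n - v)) \<le> 2 * l n * (w n \<bullet> (x n - v))"
      using l(1)[of n] by (intro mult_left_mono) (auto simp: inner_diff_left)
    ultimately show ?thesis by simp
  qed
  obtain \<delta> M where \<delta>: "\<delta> > 0" and M: "\<And>v \<eta>. \<eta> \<in> B v \<Longrightarrow> norm v \<le> \<delta> \<Longrightarrow> norm \<eta> \<le> M"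
    using monotone_op_locally_bounded[OF mono dom, of 0] by auto
  have M0: "M \<ge> 0"
  proof -
    obtain \<eta> where "\<eta> \<in> B 0" using dom by (auto simp: op_domain_def)
    then show ?thesis using order_trans[OF norm_ge_zero M[of \<eta> 0]] \<delta> by simp
  qed
  have fejer: "(norm (x (Suc n) - v))\<^sup>2 \<le> (norm (x n - v))\<^sup>2 + 2 * l n * (M * norm (x n - v)) + e n"
    if v: "norm v \<le> \<delta>" for n v
  proof -
    obtain \<eta> where \<eta>: "\<eta> \<in> B v" using dom by (auto simp: op_domain_def)
    have "- (\<eta> \<bullet> (x n - v)) \<le> norm \<eta> * norm (x n - v)"
      using norm_cauchy_schwarz[of "- \<eta>" "x n - v"] by simp
    also have "\<dots> \<le> M * norm (x n - v)"
      using M[OF \<eta> v] by (intro mult_right_mono) auto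
    finally have "2 * l n * (- (\<eta> \<bullet> (x n - v))) \<le> 2 * l n * (M * norm (x n - v))"
      using l(1)[of n] by (intro mult_left_mono) auto
    then show ?thesis using step[OF \<eta>, of n] by linarith
  qed
  define b where "b n = M * l n + e n" for n
  have b: "b n \<ge> 0" for n using M0 l(1)[of n] e0[of n] by (simp add: b_def)
  have sb: "summable b" unfolding b_def using l(2) se by (intro summable_add summable_mult)
  \<comment> \<open>Discrete Gronwall: \<open>2 * q \<le> 1 + q\<^sup>2\<close> turns the linear
    perturbation into a factor \<open>1 + b n\<close>, which is at most
    \<open>exp (b n)\<close>.\<close>
  have grow: "1 + (norm (x n))\<^sup>2 \<le> (1 + (norm (x 0))\<^sup>2) * exp (\<Sum>k<n. b k)" for n
  proof (induction n)
    case (Suc n)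
    define q where "q = norm (x n)"
    have "2 * q \<le> 1 + q\<^sup>2" using zero_le_power2[of "q - 1"] by (simp add: power2_diff)
    then have "M * l n * (2 * q) \<le> M * l n * (1 + q\<^sup>2)" using M0 l by (intro mult_left_mono) auto
    moreover have "e n \<le> e n * (1 + q\<^sup>2)" using e0[of n] by (simp add: distrib_left)
    moreover have "(norm (x (Suc n)))\<^sup>2 \<le> q\<^sup>2 + 2 * l n * (M * q) + e n"
      using fejer[of 0 n] \<delta> by (simp add: q_def)
    ultimately have "1 + (norm (x (Suc n)))\<^sup>2 \<le> (1 + q\<^sup>2) * (1 + b n)"
      by (simp add: b_def algebra_simps)
    also have "\<dots> \<le> (1 + q\<^sup>2) * exp (b n)" by (intro mult_left_mono) auto
    also have "\<dots> \<le> ((1 + (norm (x 0))\<^sup>2) * exp (\<Sum>k<n. b k)) * exp (b n)"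
      using Suc.IH by (intro mult_right_mono) (auto simp: q_def)
    finally show ?case by (simp add: exp_add mult.assoc)
  qed simp
  define C where "C = (1 + (norm (x 0))\<^sup>2) * exp (suminf b)"
  have C: "norm (x n) \<le> C" for n
  proof -
    have "(\<Sum>k<n. b k) \<le> suminf b" using b sb by (intro sum_le_suminf) auto
    then have "1 + (norm (x n))\<^sup>2 \<le> C"
      unfolding C_def by (intro order_trans[OF grow] mult_left_mono) auto
    moreover have "norm (x n) \<le> 1 + (norm (x n))\<^sup>2"
      using zero_le_power2[of "norm (x n) - 1"] norm_ge_zero[of "x n"]
      unfolding power2_diff one_power2 mult_1_right by linarith
    ultimately show ?thesis by simp
  qed
  define D where "D = 2 * M * (C + \<delta>)"
  \<comment> \<open>Fejer monotonicity with respect to a whole ball forces finite length of the trajectory.\<close>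
  have len: "2 * \<delta> * norm (x (Suc n) - x n) \<le> (norm (x n))\<^sup>2 - (norm (x (Suc n)))\<^sup>2 + D * l n + e n" for n
  proof -
    define d where "d = x n - x (Suc n)"
    \<comment> \<open>The centre is aimed along the current step. On expanding the squares the terms
      in \<open>norm v\<close> cancel, and \<open>2 * (v \<bullet> d)\<close> equals
      \<open>2 * \<delta> * norm d\<close>.\<close>
    define v where "v = \<delta> *\<^sub>R sgn d"
    have v: "norm v \<le> \<delta>" using \<delta> by (simp add: v_def norm_sgn)
    have vd: "v \<bullet> d = \<delta> * norm d"
      by (cases "d = 0") (auto simp: v_def sgn_div_norm dot_square_norm power2_eq_square)
    have "norm (x n - v) \<le> C + \<delta>" using norm_triangle_ineq4[of "x n" v] C[of n] v by linarith
    then have "2 * l n * (M * norm (x n - v)) \<le> 2 * l n * (M * (C + \<delta>))"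
      using M0 l(1)[of n] by (intro mult_left_mono) auto
    then have "(norm (x (Suc n) - v))\<^sup>2 \<le> (norm (x n - v))\<^sup>2 + D * l n + e n"
      using fejer[OF v, of n] by (simp add: D_def algebra_simps)
    moreover have "(norm (x (Suc n) - v))\<^sup>2 - (norm (x n - v))\<^sup>2
        = (norm (x (Suc n)))\<^sup>2 - (norm (x n))\<^sup>2 + 2 * (v \<bullet> d)"
      by (simp add: d_def power2_norm_eq_inner inner_diff_left inner_diff_right inner_commute)
    ultimately show ?thesis using vd by (simp add: d_def norm_minus_commute)
  qed
  have "summable (\<lambda>n. norm (x (Suc n) - x n))"
  proof (rule summableI_nonneg_bounded)
    fix n
    define P where "P = (norm (x 0))\<^sup>2 + (\<bar>D\<bar> * suminf l + suminf e)"
    have "2 * \<delta> * (\<Sum>i<n. norm (x (Suc i) - x i))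
        \<le> (\<Sum>i<n. ((norm (x i))\<^sup>2 - (norm (x (Suc i)))\<^sup>2) + (\<bar>D\<bar> * l i + e i))"
      unfolding sum_distrib_left
    proof (rule sum_mono)
      fix i
      have "D * l i \<le> \<bar>D\<bar> * l i" using l(1) by (intro mult_right_mono) auto
      then show "2 * \<delta> * norm (x (Suc i) - x i)
          \<le> ((norm (x i))\<^sup>2 - (norm (x (Suc i)))\<^sup>2) + (\<bar>D\<bar> * l i + e i)"
        using len[of i] by simp
    qed
    also have "\<dots> = (norm (x 0))\<^sup>2 - (norm (x n))\<^sup>2 + (\<bar>D\<bar> * sum l {..<n} + sum e {..<n})"
      by (simp add: sum.distrib sum_lessThan_telescope'[of "\<lambda>i. (norm (x i))\<^sup>2"] sum_distrib_left)
    also have "\<dots> \<le> P"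
      unfolding P_def using l se e0
      by (intro add_mono mult_left_mono sum_le_suminf) auto
    finally show "(\<Sum>i<n. norm (x (Suc i) - x i)) \<le> ((norm (x 0))\<^sup>2 + (\<bar>D\<bar> * suminf l + suminf e)) / (2 * \<delta>)"
      using \<delta> by (simp add: P_def pos_le_divide_eq mult.commute)
  qed simp
  then have "Cauchy (\<lambda>n. \<Sum>k<n. norm (x (Suc k) - x k))"
    by (simp add: summable_iff_convergent convergent_Cauchy)
  moreover have "dist (x m) (x n) ^ 1
      \<le> dist (\<Sum>k<m. norm (x (Suc k) - x k)) (\<Sum>k<n. norm (x (Suc k) - x k))" if "m \<le> n" for m n
    using that
  proof (induction n rule: dec_induct)
    case (step n)
    define s where "s n = (\<Sum>k<n. norm (x (Suc k) - x k))" for n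
    have "s m \<le> s n" unfolding s_def using step by (intro sum_mono2) auto
    moreover have "s (Suc n) = s n + norm (x (Suc n) - x n)" by (simp add: s_def)
    moreover have "dist (x m) (x (Suc n)) \<le> dist (x m) (x n) + norm (x (Suc n) - x n)"
      using dist_triangle[of "x m" "x (Suc n)" "x n"] by (simp add: dist_norm norm_minus_commute)
    ultimately show ?case using step.IH by (simp add: s_def[symmetric] dist_real_def)
  qed simp
  ultimately have "Cauchy x" by (rule Cauchy_if_dist_power_le)
  then obtain c where c: "x \<longlonglongrightarrow> c" using Cauchy_convergent convergent_def by blast
  \<comment> \<open>Local boundedness at the limit controls a tail of \<open>w\<close>; the finitely
    many other terms are absorbed by \<open>BfunI\<close>.\<close>
  obtain \<delta>' M' where "\<delta>' > 0" and M': "\<And>v \<eta>. \<eta> \<in> B v \<Longrightarrow> norm (v - c) \<le> \<delta>' \<Longrightarrow> norm \<eta> \<le> M'"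
    using monotone_op_locally_bounded[OF mono dom, of c] by blast
  then have "\<forall>\<^sub>F n in sequentially. norm (x n - c) < \<delta>'"
    using c by (auto simp: tendsto_iff dist_norm)
  then have "\<forall>\<^sub>F n in sequentially. norm (w n) \<le> M'"
    by eventually_elim (use M' w in force)
  then have "Bseq w" by (rule BfunI)
  then show ?thesis by (auto simp: Bseq_def)
qed

section \<open>Existence of regularized zeros\<close>

text \<open>\<open>c\<close> plays the role of a weak cluster point. It is the strong limit of
  almost shortest elements \<open>p N\<close> of the convex hulls of the tails, and a convex set
  containing a tail contains the hull of that tail.\<close>

lemma bounded_seq_limit_in_convex_sets:
  fixes s :: "nat \<Rightarrow> 'a::{real_inner, complete_space}"
  assumes R: "\<And>n. norm (s n) \<le> R"
  shows "\<exists>c. \<forall>D. closed D \<longrightarrow> convex D \<longrightarrow> (\<forall>\<^sub>F n in sequentially. s n \<in> D) \<longrightarrow> c \<in> D"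
proof -
  define K where "K N = convex hull (s ` {N..})" for N
  have sK: "s N \<in> K N" for N unfolding K_def by (rule hull_inc) auto
  have anti: "K n \<subseteq> K m" if "m \<le> n" for m n
    unfolding K_def using that by (intro hull_mono image_mono) auto
  define d where "d N = Inf (norm ` K N)" for N
  have bdd: "bdd_below (norm ` K N)" for N by (rule bdd_belowI[of _ 0]) auto
  have d_le: "d N \<le> norm p" if "p \<in> K N" for p N
    unfolding d_def using bdd that by (intro cInf_lower) auto
  have d0: "d N \<ge> 0" for N
    unfolding d_def using sK[of N] by (intro cInf_greatest) auto
  have "incseq d"
  proof (rule incseq_SucI)
    fix n
    show "d n \<le> d (Suc n)"
      unfolding d_def using sK[of "Suc n"] bdd anti[of n "Suc n"]
      by (intro cInf_superset_mono image_mono) auto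
  qed
  moreover have "d n \<le> R" for n using d_le[OF sK] R by (rule order_trans)
  ultimately obtain L where L: "d \<longlonglongrightarrow> L" "\<And>n. d n \<le> L" using incseq_convergent by metis
  have "\<exists>p\<in>K N. norm p < d N + 1 / real (Suc N)" for N
  proof -
    have "norm ` K N \<noteq> {}" using sK by blast
    then show ?thesis
      using cInf_lessD[of "norm ` K N" "d N + 1 / real (Suc N)"] by (auto simp: d_def)
  qed
  then obtain p where p: "\<And>N. p N \<in> K N" "\<And>N. norm (p N) < d N + 1 / real (Suc N)" by metis
  \<comment> \<open>Parallelogram law: for later indices \<open>m\<close> and \<open>n\<close> the
    midpoint of \<open>p m\<close> and \<open>p n\<close> lies in \<open>K N\<close>, so its norm is
    at least \<open>d N\<close>, while both norms are at most \<open>L + 1 / real (Suc N)\<close>.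
    This leaves \<open>g N\<close> for the squared distance.\<close>
  define g where "g N = 4 * (L + 1 / real (Suc N))\<^sup>2 - 4 * (d N)\<^sup>2" for N
  have "g \<longlonglongrightarrow> 4 * (L + 0)\<^sup>2 - 4 * L\<^sup>2"
    unfolding g_def by (intro tendsto_intros L LIMSEQ_Suc[OF lim_1_over_n])
  then have g: "g \<longlonglongrightarrow> 0" by simp
  have dist: "(dist (p m) (p n))\<^sup>2 \<le> g N" if "N \<le> m" "N \<le> n" for m n N
  proof -
    have small: "(norm (p k))\<^sup>2 \<le> (L + 1 / real (Suc N))\<^sup>2" if "N \<le> k" for k
    proof (rule power_mono)
      have "1 / real (Suc k) \<le> 1 / real (Suc N)" using that by (simp add: frac_le)
      then show "norm (p k) \<le> L + 1 / real (Suc N)" using p(2)[of k] L(2)[of k] by linarith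
    qed simp
    have "(1 / 2) *\<^sub>R p m + (1 / 2) *\<^sub>R p n \<in> K N"
      using p(1) anti[OF that(1)] anti[OF that(2)] unfolding K_def
      by (intro convexD[OF convex_convex_hull]) auto
    then have "(d N)\<^sup>2 \<le> (norm ((1 / 2) *\<^sub>R p m + (1 / 2) *\<^sub>R p n))\<^sup>2"
      using d0 d_le by (intro power_mono) auto
    then have "4 * (d N)\<^sup>2 \<le> (norm (p m))\<^sup>2 + (norm (p n))\<^sup>2 + 2 * (p m \<bullet> p n)"
      by (simp add: power2_norm_eq_inner inner_add_left inner_add_right inner_commute)
    moreover have "(dist (p m) (p n))\<^sup>2 = (norm (p m))\<^sup>2 + (norm (p n))\<^sup>2 - 2 * (p m \<bullet> p n)"
      by (simp add: dist_norm power2_norm_eq_inner inner_diff_left inner_diff_right inner_commute)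
    ultimately show ?thesis using small[OF that(1)] small[OF that(2)] unfolding g_def by linarith
  qed
  have "Cauchy p"
  proof (rule metric_CauchyI)
    fix e :: real
    assume e: "e > 0"
    then have "\<forall>\<^sub>F N in sequentially. g N < e\<^sup>2" by (intro order_tendstoD[OF g]) simp
    then obtain N where N: "g N < e\<^sup>2" by (auto simp: eventually_sequentially)
    have "dist (p m) (p n) < e" if "m \<ge> N" "n \<ge> N" for m n
      using dist[OF that] N e by (intro power_less_imp_less_base[of _ 2 e]) auto
    then show "\<exists>M. \<forall>m\<ge>M. \<forall>n\<ge>M. dist (p m) (p n) < e" by blast
  qed
  then obtain c where c: "p \<longlonglongrightarrow> c" using Cauchy_convergent convergent_def by blast
  have "c \<in> D" if "closed D" "convex D" "\<forall>\<^sub>F n in sequentially. s n \<in> D" for D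
  proof -
    obtain N where N: "\<And>n. n \<ge> N \<Longrightarrow> s n \<in> D"
      using \<open>\<forall>\<^sub>F n in sequentially. s n \<in> D\<close> by (auto simp: eventually_sequentially)
    then have "K N \<subseteq> D" unfolding K_def using \<open>convex D\<close> by (intro hull_minimal) auto
    then have "\<forall>\<^sub>F n in sequentially. p n \<in> D"
      using p(1) anti unfolding eventually_sequentially by (meson subsetD)
    then show ?thesis using \<open>closed D\<close> c by (metis Lim_in_closed_set trivial_limit_sequentially)
  qed
  then show ?thesis by blast
qed

section \<open>Maximality and solvability of the regularized inclusion\<close>

text \<open>Otherwise adjoining \<open>y0\<close> to the values at \<open>x0\<close> would extend
  the graph properly and keep it monotone.\<close>

lemma maximal_monotone_memI:
  assumes max: "maximal_monotone A" and le: "\<And>v y. y \<in> A v \<Longrightarrow> (y - y0) \<bullet> (v - x0) \<ge> 0"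
  shows "y0 \<in> A x0"
proof (rule ccontr)
  assume new: "y0 \<notin> A x0"
  define B where "B = A(x0 := insert y0 (A x0))"
  have mono: "(y1 - y2) \<bullet> (x1 - x2) \<ge> 0" if "y1 \<in> A x1" "y2 \<in> A x2" for x1 x2 y1 y2
    using max that by (auto simp: maximal_monotone_def monotone_op_def)
  have le': "(y0 - y) \<bullet> (x0 - v) \<ge> 0" if "y \<in> A v" for v y
    using le[OF that] by (simp add: inner_diff_left inner_diff_right)
  have "monotone_op B"
    using mono le le' by (auto simp: monotone_op_def B_def)
  moreover have "op_graph A \<subset> op_graph B"
    using new by (auto simp: op_graph_def B_def)
  ultimately show False using max by (auto simp: maximal_monotone_def)
qed

lemma monotone_op_add_scaled:
  assumes "monotone_op A" and "t \<ge> 0"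
  shows "monotone_op (\<lambda>v. (\<lambda>y. y + t *\<^sub>R v) ` A v)"
  unfolding monotone_op_def
proof (intro allI ballI)
  fix x1 x2 y1 y2
  assume "y1 \<in> (\<lambda>y. y + t *\<^sub>R x1) ` A x1" "y2 \<in> (\<lambda>y. y + t *\<^sub>R x2) ` A x2"
  then obtain a1 a2 where a: "a1 \<in> A x1" "y1 = a1 + t *\<^sub>R x1" "a2 \<in> A x2" "y2 = a2 + t *\<^sub>R x2"
    by blast
  have "(y1 - y2) \<bullet> (x1 - x2) = (a1 - a2) \<bullet> (x1 - x2) + t * ((x1 - x2) \<bullet> (x1 - x2))"
    by (simp add: a inner_diff_left inner_add_left algebra_simps)
  moreover have "(a1 - a2) \<bullet> (x1 - x2) \<ge> 0" using assms(1) a by (auto simp: monotone_op_def)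
  ultimately show "(y1 - y2) \<bullet> (x1 - x2) \<ge> 0" using \<open>t \<ge> 0\<close> by simp
qed

lemma op_domain_add_scaled:
  "op_domain A = UNIV \<Longrightarrow> op_domain (\<lambda>v. (\<lambda>y. y + t *\<^sub>R v) ` A v) = UNIV"
  by (auto simp: op_domain_def)

text \<open>Minty's theorem for everywhere defined operators. The steps \<open>l\<close> are divergent with square
  summable lengths, so the \<open>l\<close>-weighted averages solve the variational inequality
  asymptotically, as in the subgradient method.\<close>

lemma maximal_monotone_regularized_zero:
  fixes A :: "'a::{real_inner, complete_space} operator"
  assumes max: "maximal_monotone A" and dom: "op_domain A = UNIV" and t: "t > 0"
  shows "\<exists>c. - (t *\<^sub>R c) \<in> A c"
proof -
  obtain sel where sel: "\<And>v. sel v \<in> A v"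
  proof -
    have "\<forall>v. \<exists>y. y \<in> A v" using dom by (auto simp: op_domain_def)
    then show ?thesis using that by metis
  qed
  have mono: "(y1 - y2) \<bullet> (x1 - x2) \<ge> 0" if "y1 \<in> A x1" "y2 \<in> A x2" for x1 x2 y1 y2
    using max that by (auto simp: maximal_monotone_def monotone_op_def)
  define w where "w v = sel v + t *\<^sub>R v" for v
  \<comment> \<open>Each step has length at most \<open>1 / real (Suc n)\<close>, hence the lengths
    are square summable; the summand 1 keeps the denominator positive when \<open>w v\<close>
    vanishes.\<close>
  define x where "x = rec_nat 0 (\<lambda>n v. v - (1 / (real (Suc n) * (1 + norm (w v)))) *\<^sub>R w v)"
  define l where "l n = 1 / (real (Suc n) * (1 + norm (w (x n))))" for n
  have x0: "x 0 = 0" by (simp add: x_def)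
  have x: "x (Suc n) = x n - l n *\<^sub>R w (x n)" for n by (simp add: x_def l_def)
  have l0: "l n > 0" for n by (simp add: l_def add_pos_nonneg)
  define h where "h n = 1 / real (Suc n)" for n
  have h: "0 < h n" "h n \<le> 1" for n by (auto simp: h_def)
  have lw: "l n * norm (w (x n)) \<le> h n" for n
    by (simp add: l_def h_def divide_simps add_pos_nonneg)
  have e: "(l n)\<^sup>2 * (norm (w (x n)))\<^sup>2 \<le> (h n)\<^sup>2" for n
    unfolding power_mult_distrib[symmetric] using lw l0[of n] by (intro power_mono) auto
  have sh: "summable (\<lambda>n. (h n)\<^sup>2)"
    using summable_ignore_initial_segment[OF inverse_power_summable[of 2, where 'a=real], of 1]
    by (simp add: h_def[abs_def] power_divide inverse_eq_divide)
  define E where "E = (\<Sum>n. (h n)\<^sup>2)"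
  have E: "(\<Sum>k<n. (h k)\<^sup>2) \<le> E" for n unfolding E_def using sh by (intro sum_le_suminf) auto

  \<comment> \<open>If the step sizes were summable, the directions would be bounded, so the step
    sizes would dominate a positive multiple of the harmonic series.\<close>
  have nsl: "\<not> summable l"
  proof
    assume sl: "summable l"
    define B where "B v = (\<lambda>y. y + t *\<^sub>R v) ` A v" for v
    have "monotone_op B"
      unfolding B_def using max t by (intro monotone_op_add_scaled) (auto simp: maximal_monotone_def)
    moreover have "op_domain B = UNIV" unfolding B_def by (rule op_domain_add_scaled[OF dom])
    moreover have "w (x n) \<in> B (x n)" for n using sel by (auto simp: w_def B_def)
    moreover have "summable (\<lambda>n. (l n)\<^sup>2 * (norm (w (x n)))\<^sup>2)"
      by (rule summable_comparison_test'[OF sh, of 0]) (use e in auto)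
    ultimately obtain K where K: "\<And>n. norm (w (x n)) \<le> K"
      using summable_steps_imp_bounded[of B "\<lambda>n. w (x n)" x l] x l0 sl less_imp_le by metis
    have K1: "0 < 1 + K" using K[of 0] norm_ge_zero[of "w (x 0)"] by linarith
    have "summable h"
    proof (rule summable_comparison_test'[of "\<lambda>n. (1 + K) * l n" 0])
      show "summable (\<lambda>n. (1 + K) * l n)" using sl by (rule summable_mult)
      fix n :: nat
      have "h n = (1 + norm (w (x n))) * l n"
        using add_pos_nonneg[of 1 "norm (w (x n))"] by (simp add: h_def l_def)
      also have "\<dots> \<le> (1 + K) * l n" using K l0[of n] by (intro mult_right_mono) auto
      finally show "norm (h n) \<le> (1 + K) * l n" using h[of n] by simp
    qed
    then have "summable (\<lambda>n. inverse (of_nat (Suc n)) :: real)"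
      by (simp add: h_def[abs_def] inverse_eq_divide)
    then show False
      using not_summable_harmonic[where 'a=real] summable_Suc_iff[of "\<lambda>n. inverse (real n)"] by blast
  qed

  \<comment> \<open>Outside the ball of radius \<open>norm (sel 0) / t\<close> the direction
    satisfies \<open>w (x n) \<bullet> x n \<ge> 0\<close>, so the squared norm grows by at most the
    squared step length. Inside, one step of length at most 1 stays below \<open>r\<close>, whence
    the summand 1.\<close>
  define r where "r = norm (sel 0) / t + 1"
  have bound: "(norm (x n))\<^sup>2 \<le> r\<^sup>2 + (\<Sum>k<n. (h k)\<^sup>2)" for n
  proof (induction n)
    case (Suc n)
    show ?case
    proof (cases "norm (x n) * t \<ge> norm (sel 0)")
      case True
      have "(sel (x n) - sel 0) \<bullet> (x n - 0) \<ge> 0" by (intro mono sel)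
      then have "w (x n) \<bullet> x n \<ge> sel 0 \<bullet> x n + t * (norm (x n))\<^sup>2"
        by (simp add: w_def inner_diff_left inner_add_left power2_norm_eq_inner)
      moreover have "- (sel 0 \<bullet> x n) \<le> norm (sel 0) * norm (x n)"
        using norm_cauchy_schwarz[of "- sel 0" "x n"] by simp
      moreover have "norm (sel 0) * norm (x n) \<le> (norm (x n) * t) * norm (x n)"
        using True by (intro mult_right_mono) auto
      ultimately have "w (x n) \<bullet> x n \<ge> 0" by (simp add: power2_eq_square algebra_simps)
      moreover have "(norm (x (Suc n)))\<^sup>2 = (norm (x n))\<^sup>2 - 2 * (l n * (w (x n) \<bullet> x n))
          + (l n)\<^sup>2 * (norm (w (x n)))\<^sup>2"
        unfolding x power2_norm_eq_inner
        by (simp add: inner_diff_left inner_diff_right inner_commute power2_eq_square)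
      ultimately have "(norm (x (Suc n)))\<^sup>2 \<le> (norm (x n))\<^sup>2 + (h n)\<^sup>2"
        using e[of n] l0[of n] mult_nonneg_nonneg[of "l n" "w (x n) \<bullet> x n"] by linarith
      then show ?thesis using Suc.IH by simp
    next
      case False
      have "norm (x (Suc n)) \<le> norm (x n) + l n * norm (w (x n))"
        using norm_triangle_ineq4[of "x n" "l n *\<^sub>R w (x n)"] l0[of n] by (simp add: x)
      also have "\<dots> \<le> r"
      proof -
        have "norm (x n) < norm (sel 0) / t" using False t by (simp add: pos_less_divide_eq)
        then show ?thesis using lw[of n] h[of n] unfolding r_def by linarith
      qed
      finally have "(norm (x (Suc n)))\<^sup>2 \<le> r\<^sup>2" by (intro power_mono) auto
      moreover have "0 \<le> (\<Sum>k<Suc n. (h k)\<^sup>2)" by (intro sum_nonneg) auto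
      ultimately show ?thesis by linarith
    qed
  qed (simp add: x0)
  have xR: "norm (x n) \<le> sqrt (r\<^sup>2 + E)" for n
    using bound[of n] E[of n] by (intro real_le_rsqrt) linarith

  define S where "S N = (\<Sum>n\<le>N. l n)" for N
  have S0: "S N > 0" for N unfolding S_def using l0 by (intro sum_pos) auto
  have S_mono: "S m \<le> S n" if "m \<le> n" for m n
    unfolding S_def using that l0 by (intro sum_mono2) (auto intro: less_imp_le)
  have S_top: "\<exists>N. S N > M" for M
  proof (rule ccontr)
    assume "\<not> ?thesis"
    then have "summable l"
      using l0 unfolding S_def by (intro bounded_imp_summable[of l M]) (auto simp: not_less intro: less_imp_le)
    with nsl show False ..
  qed
  define xbar where "xbar N = (\<Sum>n\<le>N. (l n / S N) *\<^sub>R x n)" for N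
  have wt: "(\<Sum>n\<le>N. l n / S N) = 1" for N
    using S0[of N] by (simp add: sum_divide_distrib[symmetric] S_def)
  have wt0: "l n / S N \<ge> 0" for n N using l0[of n] S0[of N] by simp
  have "norm (xbar N) \<le> sqrt (r\<^sup>2 + E)" for N
  proof -
    have "xbar N \<in> cball 0 (sqrt (r\<^sup>2 + E))"
      unfolding xbar_def by (rule convex_sum) (use wt wt0 xR in auto)
    then show ?thesis by simp
  qed
  then obtain c where c: "\<And>D. closed D \<Longrightarrow> convex D \<Longrightarrow> \<forall>\<^sub>F n in sequentially. xbar n \<in> D \<Longrightarrow> c \<in> D"
    using bounded_seq_limit_in_convex_sets[of xbar] by metis

  have key: "(y + t *\<^sub>R c) \<bullet> (c - v) \<le> 0" if y: "y \<in> A v" for v y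
  proof -
    \<comment> \<open>Monotonicity replaces the value at the iterate by the fixed \<open>y\<close>.
      The resulting \<open>q\<close> is convex, so Jensen's inequality moves the estimate to the
      averages, and its closed convex sublevel sets move it to \<open>c\<close>.\<close>
    define q where "q z = (y + t *\<^sub>R z) \<bullet> (z - v)" for z
    have conv: "convex_on UNIV q"
    proof (rule convex_onI)
      fix a :: real and z1 z2 :: 'a
      assume a: "0 < a" "a < 1"
      have "(1 - a) * q z1 + a * q z2 - q ((1 - a) *\<^sub>R z1 + a *\<^sub>R z2)
          = t * (a * (1 - a)) * ((z1 - z2) \<bullet> (z1 - z2))"
        by (simp add: q_def inner_add_left inner_add_right inner_diff_left inner_diff_right
            inner_commute algebra_simps)
      also have "\<dots> \<ge> 0" using a t by simp
      finally show "q ((1 - a) *\<^sub>R z1 + a *\<^sub>R z2) \<le> (1 - a) * q z1 + a * q z2" by simp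
    qed simp
    \<comment> \<open>Half of the telescoped total; \<open>norm v\<close> is the distance from the
      starting point \<open>x 0 = 0\<close> to \<open>v\<close>.\<close>
    define C where "C = ((norm v)\<^sup>2 + E) / 2"
    have "(\<Sum>n\<le>N. l n * q (x n)) \<le> C" for N
    proof -
      have "2 * (l n * q (x n)) \<le> ((norm (x n - v))\<^sup>2 - (norm (x (Suc n) - v))\<^sup>2) + (h n)\<^sup>2" for n
      proof -
        have "(sel (x n) - y) \<bullet> (x n - v) \<ge> 0" by (intro mono sel y)
        then have "q (x n) \<le> w (x n) \<bullet> (x n - v)"
          by (simp add: q_def w_def inner_diff_left inner_add_left)
        then have "l n * q (x n) \<le> l n * (w (x n) \<bullet> (x n - v))"
          using l0[of n] by (intro mult_left_mono) auto
        moreover have "(norm (x (Suc n) - v))\<^sup>2 = (norm (x n - v))\<^sup>2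
            - 2 * (l n * (w (x n) \<bullet> (x n - v))) + (l n)\<^sup>2 * (norm (w (x n)))\<^sup>2"
          unfolding x power2_norm_eq_inner
          by (simp add: inner_diff_left inner_diff_right inner_commute power2_eq_square algebra_simps)
        ultimately show ?thesis using e[of n] by linarith
      qed
      then have "2 * (\<Sum>n<Suc N. l n * q (x n))
          \<le> (\<Sum>n<Suc N. ((norm (x n - v))\<^sup>2 - (norm (x (Suc n) - v))\<^sup>2) + (h n)\<^sup>2)"
        unfolding sum_distrib_left by (intro sum_mono)
      also have "\<dots> = (norm (x 0 - v))\<^sup>2 - (norm (x (Suc N) - v))\<^sup>2 + (\<Sum>n<Suc N. (h n)\<^sup>2)"
        by (simp only: sum.distrib sum_lessThan_telescope'[of "\<lambda>n. (norm (x n - v))\<^sup>2"])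
      also have "\<dots> \<le> (norm v)\<^sup>2 + E"
        using E[of "Suc N"] zero_le_power2[of "norm (x (Suc N) - v)"]
        unfolding x0 diff_0 norm_minus_cancel by linarith
      finally show ?thesis by (simp only: C_def lessThan_Suc_atMost) simp
    qed
    then have "(\<Sum>n\<le>N. l n * q (x n)) / S N \<le> C / S N" for N
      using S0[of N] by (intro divide_right_mono) auto
    moreover have "q (xbar N) \<le> (\<Sum>n\<le>N. l n * q (x n)) / S N" for N
      using convex_on_sum[of "{..N}" UNIV q "\<lambda>n. l n / S N" x] conv wt wt0
      by (simp add: xbar_def sum_divide_distrib)
    ultimately have qbar: "q (xbar N) \<le> C / S N" for N by (meson order_trans)
    have C0: "C \<ge> 0" using E[of 0] by (simp add: C_def)
    have "q c \<le> \<epsilon>" if \<epsilon>: "\<epsilon> > 0" for \<epsilon>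
    proof -
      obtain N where N: "S N > C / \<epsilon>" using S_top by blast
      have "q (xbar n) \<le> \<epsilon>" if "n \<ge> N" for n
      proof -
        have "C / \<epsilon> \<le> S n" using N S_mono[OF that] by linarith
        then have "C / S n \<le> \<epsilon>" using \<epsilon> S0[of n] by (simp add: field_simps)
        with qbar[of n] show ?thesis by linarith
      qed
      then have "\<forall>\<^sub>F n in sequentially. xbar n \<in> {z. q z \<le> \<epsilon>}"
        by (auto simp: eventually_sequentially)
      moreover have "closed {z. q z \<le> \<epsilon>}"
        unfolding q_def by (intro closed_Collect_le continuous_intros)
      moreover have "convex {z. q z \<le> \<epsilon>}"
      proof (rule convexI)
        fix z1 z2 :: 'a and a b :: real
        assume "z1 \<in> {z. q z \<le> \<epsilon>}" "z2 \<in> {z. q z \<le> \<epsilon>}" "0 \<le> a" "0 \<le> b" "a + b = 1"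
        then show "a *\<^sub>R z1 + b *\<^sub>R z2 \<in> {z. q z \<le> \<epsilon>}"
          using convex_lower[OF conv, of z1 z2 a b] by auto
      qed
      ultimately show ?thesis using c by blast
    qed
    then have "q c \<le> 0" by (rule field_le_epsilon[of _ 0, simplified])
    then show ?thesis by (simp add: q_def)
  qed
  have "- (t *\<^sub>R c) \<in> A c"
  proof (rule maximal_monotone_memI[OF max])
    fix v y
    assume "y \<in> A v"
    from key[OF this] show "(y - - (t *\<^sub>R c)) \<bullet> (v - c) \<ge> 0"
      by (simp add: inner_diff_right)
  qed
  then show ?thesis by blast
qed

section \<open>Asymptotics of regularized zeros\<close>

text \<open>Twice the inner product equals \<open>(t + s) * (norm (a - b))\<^sup>2 - (t - s) *
  ((norm b)\<^sup>2 - (norm a)\<^sup>2)\<close>, and \<open>t - s \<le> t + s\<close>. It serves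
  both for the regularized zeros and, with reciprocal weights, for their scaled versions.\<close>

lemma norm_diff_le_if_scaled_monotone:
  fixes a b :: "'a::real_inner"
  assumes st: "0 < s" "s \<le> t" and le: "(t *\<^sub>R a - s *\<^sub>R b) \<bullet> (a - b) \<le> 0"
  shows "(norm (a - b))\<^sup>2 \<le> (norm b)\<^sup>2 - (norm a)\<^sup>2"
proof (cases "a = b")
  case False
  have "2 * ((t *\<^sub>R a - s *\<^sub>R b) \<bullet> (a - b))
      = (t + s) * (norm (a - b))\<^sup>2 - (t - s) * ((norm b)\<^sup>2 - (norm a)\<^sup>2)"
    unfolding power2_norm_eq_inner
    by (simp add: inner_diff_left inner_diff_right inner_commute algebra_simps)
  then have main: "(t + s) * (norm (a - b))\<^sup>2 \<le> (t - s) * ((norm b)\<^sup>2 - (norm a)\<^sup>2)"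
    using le by simp
  moreover have "(t + s) * (norm (a - b))\<^sup>2 > 0" using False st by simp
  \<comment> \<open>The sign must be known before \<open>t - s\<close> may be enlarged to
    \<open>t + s\<close>; the case \<open>a = b\<close> is split off to make it strict.\<close>
  ultimately have "(norm b)\<^sup>2 - (norm a)\<^sup>2 > 0"
    using st by (metis diff_ge_0_iff_ge dual_order.strict_trans1 zero_less_mult_pos zero_less_mult_iff not_less)
  then have "(t - s) * ((norm b)\<^sup>2 - (norm a)\<^sup>2) \<le> (t + s) * ((norm b)\<^sup>2 - (norm a)\<^sup>2)"
    using st by (intro mult_right_mono) linarith+
  with main have "(t + s) * (norm (a - b))\<^sup>2 \<le> (t + s) * ((norm b)\<^sup>2 - (norm a)\<^sup>2)" by linarith
  then show ?thesis using st by simp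
qed simp

text \<open>The inequality is a form of the variational characterization of the projection of 0; it
  yields minimality and uniqueness together.\<close>

lemma min_norm_in_iff:
  assumes q: "q \<in> S" and le: "\<And>p. p \<in> S \<Longrightarrow> (norm (q - p))\<^sup>2 \<le> (norm p)\<^sup>2 - (norm q)\<^sup>2"
  shows "min_norm_in S p \<longleftrightarrow> p = q"
proof
  assume p: "min_norm_in S p"
  then have "p \<in> S" "norm p \<le> norm q" using q by (auto simp: is_arg_min_def not_less)
  then have "(norm p)\<^sup>2 \<le> (norm q)\<^sup>2" by (intro power_mono) auto
  with le[OF \<open>p \<in> S\<close>] have "(norm (q - p))\<^sup>2 \<le> 0" by linarith
  then show "p = q" by simp
next
  assume "p = q"
  moreover have "norm q \<le> norm y" if "y \<in> S" for y
    using le[OF that] zero_le_power2[of "norm (q - y)"] by - (rule power2_le_imp_le[OF _ norm_ge_zero], linarith)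
  ultimately show "min_norm_in S p" using q by (auto simp: is_arg_min_def not_less)
qed

section \<open>Monotone behaviour and limits of regularized zeros\<close>

locale regularized_zeros =
  fixes A :: "'a::{real_inner, complete_space} operator" and \<theta> :: "nat \<Rightarrow> real" and u :: "nat \<Rightarrow> 'a"
  assumes max: "maximal_monotone A"
    and pos: "\<And>k. \<theta> k > 0" and dec: "decseq \<theta>" and lim: "\<theta> \<longlonglongrightarrow> 0"
    and u: "\<And>k. - (\<theta> k *\<^sub>R u k) \<in> A (u k)"
begin

lemma mono: "y1 \<in> A x1 \<Longrightarrow> y2 \<in> A x2 \<Longrightarrow> (y1 - y2) \<bullet> (x1 - x2) \<ge> 0"
  using max by (auto simp: maximal_monotone_def monotone_op_def)

lemma mono_u: "(\<theta> m *\<^sub>R u m - \<theta> n *\<^sub>R u n) \<bullet> (u m - u n) \<le> 0"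
  using mono[OF u[of m] u[of n]] by (simp add: inner_diff_left inner_diff_right)

lemma dist_u_le:
  assumes "m \<le> n"
  shows "(norm (u m - u n))\<^sup>2 \<le> (norm (u n))\<^sup>2 - (norm (u m))\<^sup>2"
  using pos[of n] decseqD[OF dec assms] mono_u by (rule norm_diff_le_if_scaled_monotone)

text \<open>In terms of \<open>g k\<close>, the vectors \<open>u k\<close> carry the weights
  \<open>1 / \<theta> k\<close>, which grow with \<open>k\<close>. The same comparison therefore
  applies with the order of the indices reversed.\<close>

lemma dist_scaled_u_le:
  assumes "m \<le> n"
  shows "(norm (\<theta> m *\<^sub>R u m - \<theta> n *\<^sub>R u n))\<^sup>2 \<le> (norm (\<theta> m *\<^sub>R u m))\<^sup>2 - (norm (\<theta> n *\<^sub>R u n))\<^sup>2"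
proof -
  define g where "g k = \<theta> k *\<^sub>R u k" for k
  have ug: "u k = (1 / \<theta> k) *\<^sub>R g k" for k using pos[of k] by (simp add: g_def)
  have "((1 / \<theta> n) *\<^sub>R g n - (1 / \<theta> m) *\<^sub>R g m) \<bullet> (g n - g m) \<le> 0"
    using mono_u[of n m] ug[of m] ug[of n] by (metis g_def inner_commute)
  then have "(norm (g n - g m))\<^sup>2 \<le> (norm (g m))\<^sup>2 - (norm (g n))\<^sup>2"
    using pos[of n] pos[of m] decseqD[OF dec assms]
    by (intro norm_diff_le_if_scaled_monotone[of "1 / \<theta> m" "1 / \<theta> n"]) (auto simp: frac_le)
  then show ?thesis by (simp add: g_def norm_minus_commute)
qed

lemma norm_u_mono: "m \<le> n \<Longrightarrow> norm (u m) \<le> norm (u n)"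
  using dist_u_le[of m n] zero_le_power2[of "norm (u m - u n)"] by - (rule power2_le_imp_le[OF _ norm_ge_zero], linarith)

text \<open>The squared norms increase and are bounded, so they control the distances of the
  \<open>u k\<close>. Along the convergent sequence \<open>\<theta> k *\<^sub>R u k\<close> tends to
  0, and maximality puts the limit among the zeros.\<close>

lemma bounded_imp_convergent_to_zero:
  assumes "\<And>k. norm (u k) \<le> C"
  shows "\<exists>q\<in>op_zeros A. u \<longlonglongrightarrow> q"
proof -
  have "Cauchy (\<lambda>k. (norm (u k))\<^sup>2)"
  proof (rule convergent_Cauchy)
    have "incseq (\<lambda>k. (norm (u k))\<^sup>2)"
      using norm_u_mono by (auto simp: incseq_def)
    moreover have "(norm (u k))\<^sup>2 \<le> C\<^sup>2" for k using assms by (intro power_mono) auto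
    ultimately obtain L where "(\<lambda>k. (norm (u k))\<^sup>2) \<longlonglongrightarrow> L" using incseq_convergent by metis
    then show "convergent (\<lambda>k. (norm (u k))\<^sup>2)" by (auto simp: convergent_def)
  qed
  moreover have "dist (u m) (u n) ^ 2 \<le> dist ((norm (u m))\<^sup>2) ((norm (u n))\<^sup>2)" if "m \<le> n" for m n
    using dist_u_le[OF that] by (simp add: dist_norm)
  ultimately have "Cauchy u" by (rule Cauchy_if_dist_power_le)
  then obtain q where q: "u \<longlonglongrightarrow> q" using Cauchy_convergent convergent_def by blast
  have "0 \<in> A q"
  proof (rule maximal_monotone_memI[OF max])
    fix v y
    assume y: "y \<in> A v"
    have "(\<lambda>k. (y + \<theta> k *\<^sub>R u k) \<bullet> (v - u k)) \<longlonglongrightarrow> (y + 0 *\<^sub>R q) \<bullet> (v - q)"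
      by (intro tendsto_intros lim q)
    moreover have "(y + \<theta> k *\<^sub>R u k) \<bullet> (v - u k) \<ge> 0" for k
      using mono[OF y u[of k]] by simp
    ultimately have "(y + 0 *\<^sub>R q) \<bullet> (v - q) \<ge> 0"
      by (intro LIMSEQ_le_const) auto
    then show "(y - 0) \<bullet> (v - q) \<ge> 0" by simp
  qed
  with q show ?thesis by (auto simp: op_zeros_def)
qed

text \<open>Monotonicity between the graph points at \<open>u k\<close> and \<open>(p, 0)\<close>,
  divided by \<open>\<theta> k\<close>. It bounds the sequence and, in the limit, shows
  minimality.\<close>

lemma dist_zero_le:
  assumes "p \<in> op_zeros A"
  shows "(norm (u k - p))\<^sup>2 \<le> (norm p)\<^sup>2 - (norm (u k))\<^sup>2"
proof -
  have "\<theta> k * (u k \<bullet> (u k - p)) \<le> 0"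
    using mono[OF u[of k], of 0 p] assms by (simp add: op_zeros_def)
  then have "u k \<bullet> (u k - p) \<le> 0" using pos[of k] by (simp add: mult_le_0_iff)
  then show ?thesis
    unfolding power2_norm_eq_inner by (simp add: inner_diff_left inner_diff_right inner_commute)
qed

lemma tendsto_min_norm_zero:
  assumes "op_zeros A \<noteq> {}"
  shows "\<exists>q. u \<longlonglongrightarrow> q \<and> (\<forall>p. min_norm_in (op_zeros A) p \<longleftrightarrow> p = q)"
proof -
  obtain p where p: "p \<in> op_zeros A" using assms ex_in_conv by metis
  have "norm (u k) \<le> norm p" for k
    using dist_zero_le[OF p, of k] zero_le_power2[of "norm (u k - p)"]
    by - (rule power2_le_imp_le[OF _ norm_ge_zero], linarith)
  then obtain q where q: "q \<in> op_zeros A" "u \<longlonglongrightarrow> q" using bounded_imp_convergent_to_zero[of "norm p"] by blast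
  have "(norm (q - p))\<^sup>2 \<le> (norm p)\<^sup>2 - (norm q)\<^sup>2" if "p \<in> op_zeros A" for p
  proof (rule LIMSEQ_le)
    show "(\<lambda>k. (norm (u k - p))\<^sup>2) \<longlonglongrightarrow> (norm (q - p))\<^sup>2"
      by (intro tendsto_intros q(2))
    show "(\<lambda>k. (norm p)\<^sup>2 - (norm (u k))\<^sup>2) \<longlonglongrightarrow> (norm p)\<^sup>2 - (norm q)\<^sup>2"
      by (intro tendsto_intros q(2))
    show "\<exists>N. \<forall>k\<ge>N. (norm (u k - p))\<^sup>2 \<le> (norm p)\<^sup>2 - (norm (u k))\<^sup>2"
      using dist_zero_le[OF that] by blast
  qed
  then show ?thesis using min_norm_in_iff[OF q(1)] q(2) by (intro exI[of _ q]) simp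
qed

text \<open>A bounded sequence would produce a zero; since the norms increase, unboundedness already
  means divergence.\<close>

lemma norm_at_top_if_no_zeros:
  assumes "op_zeros A = {}"
  shows "filterlim (\<lambda>k. norm (u k)) at_top sequentially"
  unfolding filterlim_at_top
proof
  fix Z
  obtain k where "Z < norm (u k)"
    using bounded_imp_convergent_to_zero[of Z] assms by (metis empty_iff not_le)
  then have "\<forall>n\<ge>k. Z \<le> norm (u n)" using norm_u_mono by (meson less_imp_le order_trans)
  then show "\<forall>\<^sub>F n in sequentially. Z \<le> norm (u n)" unfolding eventually_sequentially by blast
qed

text \<open>The squared norms of \<open>g k\<close> decrease, so \<open>g\<close> is Cauchy. Its
  limit, up to sign, determines a closed half-space containing the range, and this gives the
  projection inequality on the closure.\<close>

lemma scaled_tendsto_min_norm_range: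
  "\<exists>a. (\<lambda>k. \<theta> k *\<^sub>R u k) \<longlonglongrightarrow> - a \<and> (\<forall>b. min_norm_in (closure (op_range A)) b \<longleftrightarrow> b = a)"
proof -
  define g where "g k = \<theta> k *\<^sub>R u k" for k
  have dist_g: "(norm (g m - g n))\<^sup>2 \<le> (norm (g m))\<^sup>2 - (norm (g n))\<^sup>2" if "m \<le> n" for m n
    using dist_scaled_u_le[OF that] by (simp add: g_def)
  have "Cauchy (\<lambda>k. (norm (g k))\<^sup>2)"
  proof (rule convergent_Cauchy)
    have "decseq (\<lambda>k. (norm (g k))\<^sup>2)"
      unfolding decseq_def
    proof (intro allI impI)
      fix m n :: nat
      assume "m \<le> n"
      from dist_g[OF this] show "(norm (g n))\<^sup>2 \<le> (norm (g m))\<^sup>2"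
        using zero_le_power2[of "norm (g m - g n)"] by linarith
    qed
    then obtain L where "(\<lambda>k. (norm (g k))\<^sup>2) \<longlonglongrightarrow> L"
      using decseq_convergent[of "\<lambda>k. (norm (g k))\<^sup>2" 0] zero_le_power2 by metis
    then show "convergent (\<lambda>k. (norm (g k))\<^sup>2)" by (auto simp: convergent_def)
  qed
  moreover have "dist (g m) (g n) ^ 2 \<le> dist ((norm (g m))\<^sup>2) ((norm (g n))\<^sup>2)" if "m \<le> n" for m n
    using dist_g[OF that] by (simp add: dist_norm)
  ultimately have "Cauchy g" by (rule Cauchy_if_dist_power_le)
  then obtain \<gamma> where \<gamma>: "g \<longlonglongrightarrow> \<gamma>" using Cauchy_convergent convergent_def by blast
  define a where "a = - \<gamma>"
  have lim_a: "(\<lambda>k. - g k) \<longlonglongrightarrow> a" unfolding a_def by (intro tendsto_intros \<gamma>)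
  have "- g k \<in> op_range A" for k using u[of k] by (auto simp: op_range_def g_def)
  then have a: "a \<in> closure (op_range A)" using lim_a
    unfolding closure_sequential by (intro exI[of _ "\<lambda>k. - g k"]) auto
  have "op_range A \<subseteq> {\<eta>. (norm a)\<^sup>2 \<le> a \<bullet> \<eta>}"
  proof
    fix \<eta>
    assume "\<eta> \<in> op_range A"
    then obtain v where v: "\<eta> \<in> A v" by (auto simp: op_range_def)
    \<comment> \<open>The monotonicity inequality is multiplied by \<open>\<theta> k\<close>: then
      \<open>v\<close> enters only through \<open>\<theta> k *\<^sub>R v\<close> and disappears in
      the limit.\<close>
    have "(\<lambda>k. (\<eta> + g k) \<bullet> (\<theta> k *\<^sub>R v - g k)) \<longlonglongrightarrow> (\<eta> + \<gamma>) \<bullet> (0 *\<^sub>R v - \<gamma>)"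
      by (intro tendsto_intros lim \<gamma>)
    moreover have "(\<eta> + g k) \<bullet> (\<theta> k *\<^sub>R v - g k) \<ge> 0" for k
    proof -
      have "\<theta> k * ((\<eta> + g k) \<bullet> (v - u k)) \<ge> 0"
        using mono[OF v u[of k]] pos[of k] by (simp add: g_def)
      moreover have "\<theta> k *\<^sub>R v - g k = \<theta> k *\<^sub>R (v - u k)"
        by (simp add: g_def scaleR_diff_right)
      ultimately show ?thesis by (metis inner_scaleR_right)
    qed
    ultimately have "(\<eta> + \<gamma>) \<bullet> (0 *\<^sub>R v - \<gamma>) \<ge> 0"
      by (intro LIMSEQ_le_const) auto
    then show "\<eta> \<in> {\<eta>. (norm a)\<^sup>2 \<le> a \<bullet> \<eta>}"
      by (simp add: a_def power2_norm_eq_inner inner_add_left inner_add_right inner_commute)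
  qed
  moreover have "closed {\<eta>. (norm a)\<^sup>2 \<le> a \<bullet> \<eta>}" by (intro closed_Collect_le continuous_intros)
  ultimately have sub: "closure (op_range A) \<subseteq> {\<eta>. (norm a)\<^sup>2 \<le> a \<bullet> \<eta>}" by (rule closure_minimal)
  have "(norm (a - p))\<^sup>2 \<le> (norm p)\<^sup>2 - (norm a)\<^sup>2" if "p \<in> closure (op_range A)" for p
  proof -
    have "(norm a)\<^sup>2 \<le> a \<bullet> p" using sub that by blast
    then show ?thesis
      unfolding power2_norm_eq_inner by (simp add: inner_diff_left inner_diff_right inner_commute)
  qed
  then have "\<forall>b. min_norm_in (closure (op_range A)) b \<longleftrightarrow> b = a" using min_norm_in_iff[OF a] by simp
  then show ?thesis using \<gamma> by (intro exI[of _ a]) (simp add: a_def g_def[abs_def])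
qed

section \<open>Drift between consecutive regularized zeros\<close>

lemma norm_scaled_u_le:
  assumes "z \<in> A 0"
  shows "norm (\<theta> k *\<^sub>R u k) \<le> norm z"
proof -
  have "0 \<le> (- (\<theta> k *\<^sub>R u k) - z) \<bullet> (u k - 0)" by (rule mono[OF u assms])
  also have "\<dots> = - (\<theta> k * (norm (u k))\<^sup>2) - z \<bullet> u k"
    by (simp add: inner_diff_left power2_norm_eq_inner)
  finally have "\<theta> k * (norm (u k))\<^sup>2 \<le> - (z \<bullet> u k)" by linarith
  also have "\<dots> \<le> norm z * norm (u k)" using norm_cauchy_schwarz[of "- z" "u k"] by simp
  finally have "(\<theta> k * norm (u k)) * norm (u k) \<le> norm z * norm (u k)"
    by (simp add: power2_eq_square mult.assoc)
  then show ?thesis using pos[of k] by (cases "u k = 0") (auto simp: mult_le_cancel_right)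
qed

text \<open>Accounts for the share \<open>norm z * rho \<theta> k\<close> of the radius set in Step
  3.\<close>

lemma norm_u_Suc_diff_le:
  assumes "z \<in> A 0"
  shows "norm (u k - u (Suc k)) \<le> norm z * rho \<theta> k"
proof -
  define t s where "t = \<theta> k" and "s = \<theta> (Suc k)"
  define d where "d = u k - u (Suc k)"
  have ts: "t > 0" "s > 0" "s \<le> t" using pos decseqD[OF dec, of k "Suc k"] by (auto simp: t_def s_def)
  have "(t *\<^sub>R u k - s *\<^sub>R u (Suc k)) \<bullet> d \<le> 0"
    using mono_u[of k "Suc k"] by (simp add: t_def s_def d_def)
  moreover have "t *\<^sub>R u k - s *\<^sub>R u (Suc k) = (t - s) *\<^sub>R u k + s *\<^sub>R d"
    by (simp add: d_def algebra_simps)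
  ultimately have "s * (norm d)\<^sup>2 \<le> (t - s) * (- (u k \<bullet> d))"
    by (simp add: inner_add_left power2_norm_eq_inner)
  also have "\<dots> \<le> (t - s) * (norm (u k) * norm d)"
    using norm_cauchy_schwarz[of "- u k" d] ts by (intro mult_left_mono) auto
  finally have "(s * norm d) * norm d \<le> ((t - s) * norm (u k)) * norm d"
    by (simp add: power2_eq_square mult.assoc)
  then have "s * norm d \<le> (t - s) * norm (u k)"
    using ts by (cases "d = 0") (auto simp: mult_le_cancel_right)
  then have "norm d \<le> ((t - s) * norm (u k)) / s"
    using ts by (simp add: pos_le_divide_eq mult.commute)
  \<comment> \<open>The quotient \<open>(t - s) / (t * s)\<close> is \<open>1 / s - 1 / t\<close>,
    that is \<open>rho \<theta> k\<close>.\<close>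
  also have "\<dots> = (t - s) / (t * s) * (t * norm (u k))" using ts by simp
  also have "\<dots> = rho \<theta> k * norm (\<theta> k *\<^sub>R u k)"
    using ts by (simp add: rho_def t_def[symmetric] s_def[symmetric] field_simps)
  also have "\<dots> \<le> rho \<theta> k * norm z"
  proof (rule mult_left_mono[OF norm_scaled_u_le[OF assms]])
    show "0 \<le> rho \<theta> k" using ts by (simp add: rho_def t_def[symmetric] s_def[symmetric] frac_le)
  qed
  finally show ?thesis by (simp add: d_def mult.commute)
qed

end

section \<open>Dynamics of the scheme\<close>

lemma step_size_nonneg: "t > 0 \<Longrightarrow> 0 \<le> step_size t r w"
  by (simp add: step_size_def)

lemma step_size_le: "t > 0 \<Longrightarrow> step_size t r w \<le> 1 / (2 * t)"
  by (simp add: step_size_def)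

text \<open>Due to the second entry of the minimum. With \<open>l\<close> the step size, the error
  \<open>l\<^sup>2 * (norm w)\<^sup>2\<close> uses up at most half of the decrease
  \<open>2 * t * l * r\<^sup>2\<close>.\<close>

lemma step_size_mult_norm_le:
  assumes "t > 0"
  shows "step_size t r w * (norm w)\<^sup>2 \<le> t * r\<^sup>2"
proof (cases "w = 0")
  case False
  then have "step_size t r w \<le> t * r\<^sup>2 / (norm w)\<^sup>2" by (simp add: step_size_def)
  then show ?thesis using False by (simp add: pos_le_divide_eq)
qed (use assms in simp)

text \<open>A bound independent of the iteration, for the contradiction in
  \<open>index_unbounded\<close>. The \<open>+ 1\<close> avoids a zero denominator when
  \<open>K = 0\<close>.\<close>

lemma step_size_ge:
  assumes "t > 0" "0 \<le> c" "c \<le> r" "norm w \<le> K"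
  shows "min (1 / (2 * t)) (t * c\<^sup>2 / (K\<^sup>2 + 1)) \<le> step_size t r w"
proof (cases "w = 0")
  case False
  have "(norm w)\<^sup>2 \<le> K\<^sup>2" using assms(4) by (intro power_mono) auto
  moreover have "t * c\<^sup>2 \<le> t * r\<^sup>2" using assms by (intro mult_left_mono power_mono) auto
  ultimately have "t * c\<^sup>2 / (K\<^sup>2 + 1) \<le> t * r\<^sup>2 / (norm w)\<^sup>2"
    using assms False by (intro frac_le) auto
  then show ?thesis using False by (simp add: step_size_def min.coboundedI2)
qed (simp add: step_size_def)

section \<open>Invariants of an execution\<close>

text \<open>The components of the state are indexed by the number of transitions, because Step 3
  leaves \<open>n\<close> unchanged.\<close>

locale scheme_execution = regularized_zeros A \<theta> u
  for A :: "'a::{real_inner, complete_space} operator" and \<theta> u +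
  fixes z :: 'a and N \<mu> :: "nat \<Rightarrow> nat" and X :: "nat \<Rightarrow> 'a" and R :: "nat \<Rightarrow> real"
  assumes dom: "op_domain A = UNIV" and adm: "admissible \<theta>" and z: "z \<in> A 0"
    and init: "initial_state A \<theta> (N 0, \<mu> 0, X 0, R 0)"
    and trans: "\<And>k. transition A \<theta> z (N k, \<mu> k, X k, R k) (N (Suc k), \<mu> (Suc k), X (Suc k), R (Suc k))"
begin

lemma rho_pos: "rho \<theta> n > 0"
  using adm by (simp add: admissible_def)

lemma step_cases:
  obtains (update) y w l where "rho \<theta> (\<mu> k) < R k" "y \<in> A (X k)" "w = y + \<theta> (\<mu> k) *\<^sub>R X k"
      "l = step_size (\<theta> (\<mu> k)) (R k) w" "N (Suc k) = Suc (N k)" "\<mu> (Suc k) = \<mu> k"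
      "X (Suc k) = X k - l *\<^sub>R w" "R (Suc k) \<ge> 0"
      "(R (Suc k))\<^sup>2 = (1 - 2 * \<theta> (\<mu> k) * l) * (R k)\<^sup>2 + l\<^sup>2 * (norm w)\<^sup>2"
    | (advance) "R k \<le> rho \<theta> (\<mu> k)" "N (Suc k) = N k" "\<mu> (Suc k) = Suc (\<mu> k)"
      "X (Suc k) = X k" "R (Suc k) = (1 + norm z) * rho \<theta> (\<mu> k)"
  using trans[of k] by (cases rule: transition.cases) (auto simp: not_le)

lemma radius_update:
  assumes l: "l = step_size (\<theta> (\<mu> k)) (R k) w"
    and R': "(R (Suc k))\<^sup>2 = (1 - 2 * \<theta> (\<mu> k) * l) * (R k)\<^sup>2 + l\<^sup>2 * (norm w)\<^sup>2"
  shows "(R (Suc k))\<^sup>2 \<le> (R k)\<^sup>2 - \<theta> (\<mu> k) * l * (R k)\<^sup>2"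
proof -
  have "l * (l * (norm w)\<^sup>2) \<le> l * (\<theta> (\<mu> k) * (R k)\<^sup>2)"
    using pos[of "\<mu> k"] unfolding l
    by (intro mult_left_mono step_size_mult_norm_le step_size_nonneg)
  then show ?thesis unfolding R' by (simp add: power2_eq_square algebra_simps)
qed

lemma incseq_N: "incseq N"
proof (rule incseq_SucI)
  show "N k \<le> N (Suc k)" for k by (cases rule: step_cases[of k]) auto
qed

lemma incseq_index: "incseq \<mu>"
proof (rule incseq_SucI)
  show "\<mu> k \<le> \<mu> (Suc k)" for k by (cases rule: step_cases[of k]) auto
qed

lemma dist_iterate_le: "norm (X k - u (\<mu> k)) \<le> R k"
proof (induction k)
  case 0
  obtain y0 where y0: "y0 \<in> A (X 0)" "norm (X 0 + (1 / \<theta> 0) *\<^sub>R y0) \<le> R 0" and \<mu>0: "\<mu> 0 = 0"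
    using init by (auto simp: initial_state_def)
  \<comment> \<open>Subtracting the regularized equation at \<open>u 0\<close> leaves
    \<open>\<theta> 0 *\<^sub>R (p - d)\<close>; monotonicity then bounds \<open>norm d\<close> by
    \<open>norm p\<close>, the quantity that the initial radius dominates.\<close>
  define p d where "p = X 0 + (1 / \<theta> 0) *\<^sub>R y0" and "d = X 0 - u 0"
  have "0 \<le> (y0 - - (\<theta> 0 *\<^sub>R u 0)) \<bullet> d" unfolding d_def by (rule mono[OF y0(1) u])
  also have "y0 - - (\<theta> 0 *\<^sub>R u 0) = \<theta> 0 *\<^sub>R (p - d)"
    using pos[of 0] by (simp add: p_def d_def algebra_simps)
  finally have "(norm d)\<^sup>2 \<le> p \<bullet> d"
    using pos[of 0] by (simp add: zero_le_mult_iff inner_diff_left power2_norm_eq_inner)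
  also have "\<dots> \<le> norm p * norm d" by (rule norm_cauchy_schwarz)
  finally have "norm d \<le> norm p"
    by (cases "d = 0") (auto simp: power2_eq_square mult_le_cancel_right)
  then show ?case using y0(2) by (simp add: \<mu>0 p_def d_def)
next
  case (Suc k)
  show ?case
  proof (cases rule: step_cases[of k])
    case (update y w l)
    define t d where "t = \<theta> (\<mu> k)" and "d = X k - u (\<mu> k)"
    have t: "t > 0" using pos by (simp add: t_def)
    have l: "0 \<le> l" "l \<le> 1 / (2 * t)"
      using step_size_nonneg[OF t] step_size_le[OF t] by (simp_all add: update(4) t_def)
    have "0 \<le> (y - - (t *\<^sub>R u (\<mu> k))) \<bullet> d"
      unfolding d_def t_def by (rule mono[OF update(2) u])
    also have "\<dots> = w \<bullet> d - t * (norm d)\<^sup>2"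
      by (simp add: update(3) t_def[symmetric] d_def power2_norm_eq_inner inner_add_left
          inner_diff_left inner_diff_right inner_commute algebra_simps)
    finally have "l * (t * (norm d)\<^sup>2) \<le> l * (w \<bullet> d)" using l by (intro mult_left_mono) auto
    moreover have "(norm (d - l *\<^sub>R w))\<^sup>2 = (norm d)\<^sup>2 - 2 * (l * (w \<bullet> d)) + l\<^sup>2 * (norm w)\<^sup>2"
      unfolding power2_norm_eq_inner
      by (simp add: inner_diff_left inner_diff_right inner_commute power2_eq_square)
    ultimately have "(norm (d - l *\<^sub>R w))\<^sup>2 \<le> (1 - 2 * t * l) * (norm d)\<^sup>2 + l\<^sup>2 * (norm w)\<^sup>2"
      by (simp add: algebra_simps)
    also have "\<dots> \<le> (1 - 2 * t * l) * (R k)\<^sup>2 + l\<^sup>2 * (norm w)\<^sup>2"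
    proof (intro add_right_mono mult_left_mono power_mono)
      show "norm d \<le> R k" using Suc.IH by (simp add: d_def)
      \<comment> \<open>The first entry of the minimum makes this factor nonnegative, so that the
        induction hypothesis can be inserted.\<close>
      show "0 \<le> 1 - 2 * t * l" using l(2) t by (simp add: pos_le_divide_eq mult.commute mult.left_commute)
    qed simp
    also have "\<dots> = (R (Suc k))\<^sup>2" by (simp add: update(9) t_def)
    finally have "norm (d - l *\<^sub>R w) \<le> R (Suc k)" using update(8) by (rule power2_le_imp_le)
    moreover have "X (Suc k) - u (\<mu> (Suc k)) = d - l *\<^sub>R w"
      by (simp add: update(6,7) d_def)
    ultimately show ?thesis by simp
  next
    case advance
    have "norm (X k - u (Suc (\<mu> k))) \<le> norm (X k - u (\<mu> k)) + norm (u (\<mu> k) - u (Suc (\<mu> k)))"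
      using norm_triangle_ineq[of "X k - u (\<mu> k)" "u (\<mu> k) - u (Suc (\<mu> k))"] by simp
    also have "\<dots> \<le> rho \<theta> (\<mu> k) + norm z * rho \<theta> (\<mu> k)"
      using Suc.IH advance(1) norm_u_Suc_diff_le[OF z] by (intro add_mono) auto
    finally show ?thesis by (simp add: advance algebra_simps)
  qed
qed

text \<open>The latest advance reset the radius using the old index, one below the current one, and
  updates only shrink it afterwards.\<close>

lemma radius_le_after_advance: "\<mu> k > 0 \<Longrightarrow> R k \<le> (1 + norm z) * rho \<theta> (\<mu> k - 1)"
proof (induction k)
  case 0
  then show ?case using init by (auto simp: initial_state_def)
next
  case (Suc k)
  show ?case
  proof (cases rule: step_cases[of k])
    case (update y w l)
    have R: "R k > 0" using update(1) rho_pos by (rule order_less_trans[rotated])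
    have "l \<ge> 0" unfolding update(4) by (rule step_size_nonneg[OF pos])
    then have "\<theta> (\<mu> k) * l * (R k)\<^sup>2 \<ge> 0" using pos[of "\<mu> k"] by simp
    then have "(R (Suc k))\<^sup>2 \<le> (R k)\<^sup>2" using radius_update[OF update(4,9)] by linarith
    then have "R (Suc k) \<le> R k" by (rule power2_le_imp_le) (use R in simp)
    then show ?thesis using Suc update(6) by simp
  qed simp
qed

text \<open>An infinite run of updates at a fixed index would have summable step sizes, hence bounded
  directions \<open>w\<close>, hence step sizes bounded away from 0.\<close>

lemma index_unbounded: "\<exists>k. M < \<mu> k"
proof (rule ccontr)
  assume "\<not> ?thesis"
  then have bdd: "\<mu> k \<le> M" for k by (simp add: not_less)
  then have fin: "finite (range \<mu>)" by (meson finite_atMost atMost_iff finite_subset image_subsetI)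
  then have "Max (range \<mu>) \<in> range \<mu>" by (rule Max_in) simp
  \<comment> \<open>From the moment the index attains its maximum it is constant, so every further
    transition is an update.\<close>
  then obtain k0 where k0: "\<mu> k0 = Max (range \<mu>)" by (metis imageE)
  have const: "\<mu> (k0 + j) = \<mu> k0" for j
    using incseqD[OF incseq_index, of k0 "k0 + j"] Max_ge[OF fin, of "\<mu> (k0 + j)"] k0 by simp
  define t c where "t = \<theta> (\<mu> k0)" and "c = rho \<theta> (\<mu> k0)"
  have t: "t > 0" and c: "c > 0" using pos rho_pos by (auto simp: t_def c_def)
  define x r where "x j = X (k0 + j)" and "r j = R (k0 + j)" for j
  define L where "L j y = step_size t (r j) (y + t *\<^sub>R x j)" for j y
  have "\<exists>y. c < r j \<and> y \<in> A (x j) \<and> x (Suc j) = x j - L j y *\<^sub>R (y + t *\<^sub>R x j)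
      \<and> (r (Suc j))\<^sup>2 \<le> (r j)\<^sup>2 - t * L j y * (r j)\<^sup>2" for j
  proof (cases rule: step_cases[of "k0 + j"])
    case (update y w l)
    show ?thesis
      using update(1,2,3,4,7) radius_update[OF update(4,9)]
      by (intro exI[of _ y]) (simp add: const t_def c_def x_def r_def L_def)
  next
    case advance
    then show ?thesis using const[of "Suc j"] const[of j] by simp
  qed
  then obtain y where y: "\<And>j. c < r j" "\<And>j. y j \<in> A (x j)"
      "\<And>j. x (Suc j) = x j - L j (y j) *\<^sub>R (y j + t *\<^sub>R x j)"
      "\<And>j. (r (Suc j))\<^sup>2 \<le> (r j)\<^sup>2 - t * L j (y j) * (r j)\<^sup>2"
    by metis
  define w l where "w j = y j + t *\<^sub>R x j" and "l j = L j (y j)" for j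
  have step: "c < r j" "y j \<in> A (x j)" "w j = y j + t *\<^sub>R x j" "l j = step_size t (r j) (w j)"
      "x (Suc j) = x j - l j *\<^sub>R w j" "(r (Suc j))\<^sup>2 \<le> (r j)\<^sup>2 - t * l j * (r j)\<^sup>2" for j
    using y by (auto simp: w_def l_def L_def)
  have l0: "l j \<ge> 0" for j unfolding step(4) by (rule step_size_nonneg[OF t])
  \<comment> \<open>As the radius stays above \<open>c\<close>, each drop of its square dominates a
    fixed multiple of the step size; telescoping makes the steps summable.\<close>
  have decr: "t * c\<^sup>2 * l j \<le> (r j)\<^sup>2 - (r (Suc j))\<^sup>2" for j
  proof -
    have "c\<^sup>2 \<le> (r j)\<^sup>2" using step(1)[of j] c by (intro power_mono) auto
    then have "t * l j * c\<^sup>2 \<le> t * l j * (r j)\<^sup>2" using t l0 by (intro mult_left_mono) auto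
    then show ?thesis using step(6)[of j] by (simp add: algebra_simps)
  qed
  have sum_l: "t * c\<^sup>2 * (\<Sum>j<n. l j) \<le> (r 0)\<^sup>2 - (r n)\<^sup>2" for n
  proof -
    have "t * c\<^sup>2 * (\<Sum>j<n. l j) \<le> (\<Sum>j<n. (r j)\<^sup>2 - (r (Suc j))\<^sup>2)"
      unfolding sum_distrib_left by (intro sum_mono decr)
    then show ?thesis by (simp only: sum_lessThan_telescope'[of "\<lambda>j. (r j)\<^sup>2"])
  qed
  have r_le: "(r n)\<^sup>2 \<le> (r 0)\<^sup>2" for n
  proof -
    have "0 \<le> t * c\<^sup>2 * (\<Sum>j<n. l j)" using t l0 by (intro mult_nonneg_nonneg sum_nonneg) auto
    then show ?thesis using sum_l[of n] by linarith
  qed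
  have sl: "summable l"
  proof (rule summableI_nonneg_bounded[OF l0])
    fix n
    have "t * c\<^sup>2 * (\<Sum>j<n. l j) \<le> (r 0)\<^sup>2" using sum_l[of n] zero_le_power2[of "r n"] by linarith
    moreover have "t * c\<^sup>2 > 0" using t c by simp
    ultimately show "(\<Sum>j<n. l j) \<le> (r 0)\<^sup>2 / (t * c\<^sup>2)" by (simp add: pos_le_divide_eq mult.commute)
  qed
  have sw: "summable (\<lambda>j. (l j)\<^sup>2 * (norm (w j))\<^sup>2)"
  proof (rule summable_comparison_test'[of "\<lambda>j. (t * (r 0)\<^sup>2) * l j" 0])
    show "summable (\<lambda>j. (t * (r 0)\<^sup>2) * l j)" using sl by (rule summable_mult)
    fix j :: nat
    have "l j * (norm (w j))\<^sup>2 \<le> t * (r j)\<^sup>2" unfolding step(4) by (rule step_size_mult_norm_le[OF t])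
    also have "\<dots> \<le> t * (r 0)\<^sup>2" using r_le t by simp
    finally have "(l j * (norm (w j))\<^sup>2) * l j \<le> (t * (r 0)\<^sup>2) * l j"
      using l0 by (intro mult_right_mono) auto
    moreover have "norm ((l j)\<^sup>2 * (norm (w j))\<^sup>2) = (l j * (norm (w j))\<^sup>2) * l j"
      using l0[of j] by (simp add: abs_mult power2_eq_square)
    ultimately show "norm ((l j)\<^sup>2 * (norm (w j))\<^sup>2) \<le> (t * (r 0)\<^sup>2) * l j" by linarith
  qed
  have "\<exists>K. \<forall>j. norm (w j) \<le> K"
    using monotone_op_add_scaled[of A t] op_domain_add_scaled[OF dom] max t step(2,3,5) l0 sl sw
    by (intro summable_steps_imp_bounded[where x = x and l = l
          and B = "\<lambda>v. (\<lambda>y. y + t *\<^sub>R v) ` A v"]) (auto simp: maximal_monotone_def)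
  then obtain K where K: "\<And>j. norm (w j) \<le> K" by blast
  define b where "b = min (1 / (2 * t)) (t * c\<^sup>2 / (K\<^sup>2 + 1))"
  have "K\<^sup>2 + 1 > 0" by (simp add: add_nonneg_pos)
  then have b: "b > 0" using t c by (simp add: b_def)
  have "b \<le> l j" for j
    unfolding b_def step(4) using t c step(1)[of j] K by (intro step_size_ge) auto
  moreover have "\<forall>\<^sub>F j in sequentially. l j < b"
    using summable_LIMSEQ_zero[OF sl] b by (rule order_tendstoD)
  ultimately show False by (auto simp: eventually_sequentially not_less[symmetric])
qed

end

section \<open>Transfer of the limits to the iterates\<close>

theorem mainTheorem1:
  fixes A :: "'a::{real_inner, complete_space} \<Rightarrow> 'a set"
    and \<theta> :: "nat \<Rightarrow> real" and z :: 'a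
    and x :: "nat \<Rightarrow> 'a" and m :: "nat \<Rightarrow> nat"
  assumes "maximal_monotone A"
    and "op_domain A = UNIV"
    and "admissible \<theta>"
    and "z \<in> A 0"
    and "generated A \<theta> z x m"
  shows "(op_zeros A \<noteq> {} \<longrightarrow>
      (\<exists>!p. min_norm_in (op_zeros A) p) \<and>
      (\<forall>p. min_norm_in (op_zeros A) p \<longrightarrow> x \<longlonglongrightarrow> p)) \<and>
    (op_zeros A = {} \<longrightarrow>
      filterlim (\<lambda>n. norm (x n)) at_top sequentially \<and>
      (\<exists>!a. min_norm_in (closure (op_range A)) a) \<and>
      (\<forall>a. min_norm_in (closure (op_range A)) a \<longrightarrow>
        (\<lambda>n. \<theta> (m n) *\<^sub>R x n) \<longlonglongrightarrow> - a))"
proof -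
  obtain \<sigma> where exec: "execution A \<theta> z \<sigma>"
    and gen: "\<And>n. \<exists>k r. \<sigma> k = (n, m n, x n, r) \<and> \<not> r \<le> rho \<theta> (m n)"
    using assms(5) by (auto simp: generated_def)
  have \<theta>: "\<And>k. \<theta> k > 0" "decseq \<theta>" "\<theta> \<longlonglongrightarrow> 0" "rho \<theta> \<longlonglongrightarrow> 0"
    using assms(3) by (auto simp: admissible_def)
  have "\<forall>k. \<exists>c. - (\<theta> k *\<^sub>R c) \<in> A c"
    using maximal_monotone_regularized_zero[OF assms(1,2) \<theta>(1)] by blast
  then obtain u where u: "\<And>k. - (\<theta> k *\<^sub>R u k) \<in> A (u k)" by metis
  define N \<mu> X R where "N k = fst (\<sigma> k)" and "\<mu> k = fst (snd (\<sigma> k))"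
    and "X k = fst (snd (snd (\<sigma> k)))" and "R k = snd (snd (snd (\<sigma> k)))" for k
  have \<sigma>: "\<sigma> k = (N k, \<mu> k, X k, R k)" for k by (simp add: N_def \<mu>_def X_def R_def)
  interpret scheme_execution A \<theta> u z N \<mu> X R
    using assms \<theta> u exec by unfold_locales (auto simp: execution_def \<sigma>)

  \<comment> \<open>\<open>\<kappa> n\<close> is the number of transitions made before
    \<open>x n\<close> is updated.\<close>
  obtain \<kappa> where \<kappa>: "\<And>n. N (\<kappa> n) = n" "\<And>n. \<mu> (\<kappa> n) = m n" "\<And>n. X (\<kappa> n) = x n"
    using gen unfolding \<sigma> by (metis prod.inject)
  \<comment> \<open>Once \<open>n\<close> exceeds \<open>N k\<close>, the update of
    \<open>x n\<close> happens after transition \<open>k\<close>; monotonicity of the index then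
    carries its growth over to \<open>m\<close>.\<close>
  have m_top: "filterlim m at_top sequentially"
    unfolding filterlim_at_top
  proof
    fix M
    obtain k where k: "M < \<mu> k" using index_unbounded by blast
    have "M \<le> m n" if "n > N k" for n
    proof -
      have "k \<le> \<kappa> n"
        using that \<kappa>(1)[of n] incseqD[OF incseq_N, of "\<kappa> n" k] by (cases "k \<le> \<kappa> n") auto
      then show ?thesis using incseqD[OF incseq_index, of k "\<kappa> n"] k \<kappa>(2)[of n] by simp
    qed
    then show "\<forall>\<^sub>F n in sequentially. M \<le> m n"
      by (auto intro: eventually_mono[OF eventually_gt_at_top[of "N k"]])
  qed
  have "(\<lambda>n. x n - u (m n)) \<longlonglongrightarrow> 0"
  proof (rule Lim_null_comparison)
    \<comment> \<open>The radius bound refers to the preceding index, so index 0 has to be excluded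
      before \<open>m n - 1\<close> is meaningful.\<close>
    have "\<forall>\<^sub>F n in sequentially. 1 \<le> m n"
      using m_top unfolding filterlim_at_top by blast
    then show "\<forall>\<^sub>F n in sequentially. norm (x n - u (m n)) \<le> (1 + norm z) * rho \<theta> (m n - 1)"
    proof eventually_elim
      case (elim n)
      then show ?case
        using dist_iterate_le[of "\<kappa> n"] radius_le_after_advance[of "\<kappa> n"] by (simp add: \<kappa>)
    qed
    have "filterlim (\<lambda>n. m n - 1) at_top sequentially"
      by (rule filterlim_compose[OF filterlim_minus_const_nat_at_top m_top])
    then have "(\<lambda>n. rho \<theta> (m n - 1)) \<longlonglongrightarrow> 0" by (rule filterlim_compose[OF \<theta>(4)])
    then show "(\<lambda>n. (1 + norm z) * rho \<theta> (m n - 1)) \<longlonglongrightarrow> 0"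
      by (rule tendsto_mult_right_zero)
  qed
  note near = this
  have \<theta>m: "(\<lambda>n. \<theta> (m n)) \<longlonglongrightarrow> 0" by (rule filterlim_compose[OF \<theta>(3) m_top])

  show ?thesis
  proof (intro conjI impI)
    assume "op_zeros A \<noteq> {}"
    then obtain q where q: "u \<longlonglongrightarrow> q" "\<And>p. min_norm_in (op_zeros A) p \<longleftrightarrow> p = q"
      using tendsto_min_norm_zero by blast
    have "(\<lambda>n. (x n - u (m n)) + u (m n)) \<longlonglongrightarrow> 0 + q"
      by (intro tendsto_add near filterlim_compose[OF q(1) m_top])
    then have "x \<longlonglongrightarrow> q" by simp
    then show "\<exists>!p. min_norm_in (op_zeros A) p"
      and "\<forall>p. min_norm_in (op_zeros A) p \<longrightarrow> x \<longlonglongrightarrow> p"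
      unfolding q(2) by simp_all
  next
    assume empty: "op_zeros A = {}"
    have "filterlim (\<lambda>n. norm (u (m n))) at_top sequentially"
      by (rule filterlim_compose[OF norm_at_top_if_no_zeros[OF empty] m_top])
    \<comment> \<open>This minorant of \<open>norm (x n)\<close> comes from the reverse triangle
      inequality: a null sequence plus a divergent one.\<close>
    then have "filterlim (\<lambda>n. - norm (x n - u (m n)) + norm (u (m n))) at_top sequentially"
      by (intro filterlim_tendsto_add_at_top[OF tendsto_minus[OF tendsto_norm[OF near]]])
    then show "filterlim (\<lambda>n. norm (x n)) at_top sequentially"
    proof (rule filterlim_at_top_mono)
      have "- norm (x n - u (m n)) + norm (u (m n)) \<le> norm (x n)" for n
        using norm_triangle_ineq2[of "u (m n)" "x n"] by (simp add: norm_minus_commute)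
      then show "\<forall>\<^sub>F n in sequentially. - norm (x n - u (m n)) + norm (u (m n)) \<le> norm (x n)"
        by simp
    qed
  next
    obtain a where a: "(\<lambda>k. \<theta> k *\<^sub>R u k) \<longlonglongrightarrow> - a"
        "\<And>b. min_norm_in (closure (op_range A)) b \<longleftrightarrow> b = a"
      using scaled_tendsto_min_norm_range by blast
    \<comment> \<open>The gap to the regularized zero, already vanishing, is also scaled by a null
      sequence, so only the scaled regularized zeros contribute to the limit.\<close>
    have "(\<lambda>n. \<theta> (m n) *\<^sub>R (x n - u (m n)) + \<theta> (m n) *\<^sub>R u (m n)) \<longlonglongrightarrow> 0 *\<^sub>R 0 + - a"
      by (intro tendsto_add tendsto_scaleR \<theta>m near filterlim_compose[OF a(1) m_top])
    then have "(\<lambda>n. \<theta> (m n) *\<^sub>R x n) \<longlonglongrightarrow> - a" by (simp add: scaleR_diff_right)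
    then show "\<exists>!a. min_norm_in (closure (op_range A)) a"
      and "\<forall>a. min_norm_in (closure (op_range A)) a \<longrightarrow> (\<lambda>n. \<theta> (m n) *\<^sub>R x n) \<longlonglongrightarrow> - a"
      unfolding a(2) by simp_all
  qed
qed

end
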